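(* Let $A=(a_1,b_1,c_1,d_1)$ and $B=(a_2,b_2,c_2,d_2)$ be real matrix parameters with $a_1d_1-b_1c_1=1$, $a_2d_2-b_2c_2=1$, $b_1\neq0$, $b_2\neq0$. Let $f,g\in L^2(\mathbb{R})$ be nonzero such that $uL_A^f(u),\,uL_B^f(u),\,uL_A^g(u),\,uL_B^g(u)\in L^2(\mathbb{R})$. Then the frequency spreads of the STLCTs $S^A_gf$ and $S^B_gf$ satisfy $$F^2_{A,S}\,F^2_{B,S}\ \ge\ \frac{(a_1b_2-a_2b_1)^2}{4}.$$
   Context: For a real matrix parameter $M=(a,b,c,d)$ with $ad-bc=1$ and $b\neq0$, the LCT of $h\in L^2(\mathbb{R})$ is $L_M^{h}(u)=\int h(t)K_M(t,u)\,dt$ with $K_M(t,u)=\frac{1}{\sqrt{i2\pi b}}\exp\!\big(i\frac{a}{2b}t^2-i\frac{1}{b}tu+i\frac{d}{2b}u^2\big)$. For a window $g\in L^2(\mathbb{R})$, the STLCT of $f$ with parameter $M$ is $S^{M}_{g}f(t,u)=\int f(\tau)\overline{g(\tau-t)}K_M(\tau,u)\,d\tau$. With $\|S\|^2=\iint|S^M_gf(t,u)|^2dt\,du$, the mean frequency is $\overline{u_{M,S}}=\frac{1}{\|S\|^2}\iint u|S^M_gf(t,u)|^2dt\,du$ and the frequency spread is $F^2_{M,S}=\frac{1}{\|S\|^2}\iint (u-\overline{u_{M,S}})^2|S^M_gf(t,u)|^2dt\,du$. *)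

theory Defs
  imports "HOL-Analysis.Analysis"
begin

type_synonym lct_param = "real \<times> real \<times> real \<times> real"  (* (a,b,c,d) *)

definition valid_param :: "lct_param \<Rightarrow> bool" where
  "valid_param M = (case M of (a,b,c,d) \<Rightarrow> a*d - b*c = 1 \<and> b \<noteq> 0)"

definition square_integrable :: "(real \<Rightarrow> complex) \<Rightarrow> bool" where
  "square_integrable h \<longleftrightarrow> h \<in> borel_measurable lborel \<and> integrable lborel (\<lambda>x. (cmod (h x))\<^sup>2)"

definition lct_kernel :: "lct_param \<Rightarrow> real \<Rightarrow> real \<Rightarrow> complex" where
  "lct_kernel M t u = (case M of (a,b,c,d) \<Rightarrow>
     (1 / csqrt (\<i> * 2 * complex_of_real pi * complex_of_real b)) *
     exp (\<i> * complex_of_real (a/(2*b) * t\<^sup>2 - t*u/b + d/(2*b) * u\<^sup>2)))"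

text \<open>Truncated LCT integral over [-R,R] (absolutely convergent for L2 functions).\<close>
definition lct_trunc :: "lct_param \<Rightarrow> (real \<Rightarrow> complex) \<Rightarrow> real \<Rightarrow> real \<Rightarrow> complex" where
  "lct_trunc M h R u = (LINT t:{-R..R}|lborel. h t * lct_kernel M t u)"

text \<open>F is (a representative of) the LCT of h in L2: the L2-limit of the truncated integrals.\<close>
definition is_lct :: "lct_param \<Rightarrow> (real \<Rightarrow> complex) \<Rightarrow> (real \<Rightarrow> complex) \<Rightarrow> bool" where
  "is_lct M h F \<longleftrightarrow> square_integrable F \<and>
     ((\<lambda>R. \<integral>\<^sup>+ u. ennreal ((cmod (F u - lct_trunc M h R u))\<^sup>2) \<partial>lborel) \<longlongrightarrow> 0) at_top"

definition stlct :: "lct_param \<Rightarrow> (real \<Rightarrow> complex) \<Rightarrow> (real \<Rightarrow> complex) \<Rightarrow> real \<Rightarrow> real \<Rightarrow> complex" where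
  "stlct M g f t u = (LINT \<tau>|lborel. f \<tau> * cnj (g (\<tau> - t)) * lct_kernel M \<tau> u)"

definition stlct_norm2 :: "lct_param \<Rightarrow> (real \<Rightarrow> complex) \<Rightarrow> (real \<Rightarrow> complex) \<Rightarrow> real" where
  "stlct_norm2 M g f = enn2real (\<integral>\<^sup>+ p. ennreal ((cmod (stlct M g f (fst p) (snd p)))\<^sup>2) \<partial>(lborel \<Otimes>\<^sub>M lborel))"

definition mean_freq :: "lct_param \<Rightarrow> (real \<Rightarrow> complex) \<Rightarrow> (real \<Rightarrow> complex) \<Rightarrow> real" where
  "mean_freq M g f = (1 / stlct_norm2 M g f) *
     (\<integral> p. snd p * (cmod (stlct M g f (fst p) (snd p)))\<^sup>2 \<partial>(lborel \<Otimes>\<^sub>M lborel))"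

definition freq_spread :: "lct_param \<Rightarrow> (real \<Rightarrow> complex) \<Rightarrow> (real \<Rightarrow> complex) \<Rightarrow> ennreal" where
  "freq_spread M g f = ennreal (1 / stlct_norm2 M g f) *
     (\<integral>\<^sup>+ p. ennreal ((snd p - mean_freq M g f)\<^sup>2 * (cmod (stlct M g f (fst p) (snd p)))\<^sup>2)
        \<partial>(lborel \<Otimes>\<^sub>M lborel))"

end

theory Submission
  imports Defs "HOL-Probability.Probability"
begin

text \<open>
  The transform \<open>S(t, \<cdot>)\<close> is the LCT of the slice \<open>\<tau> \<mapsto> H(t,\<tau>) = f(\<tau>) cnj (g(\<tau> - t))\<close>, which is
  integrable for every \<open>t\<close> and square integrable for almost every \<open>t\<close>. A chirp and a dilation reduce
  the LCT to the Fourier transform, so Plancherel gives \<open>\<parallel>S\<parallel> = \<parallel>H\<parallel>\<close>. Multiplying \<open>S\<close> by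
  \<open>exp (i s (u - m))\<close> corresponds to applying to \<open>H\<close> a unitary \<open>U s\<close> that translates and modulates,
  hence \<open>\<parallel>U s H - H\<parallel> \<le> \<bar>s\<bar> \<parallel>(u - m) S\<parallel>\<close>. Let \<open>U s\<close>, \<open>V s\<close> be the unitaries belonging to \<open>A\<close> and \<open>B\<close>.
  They satisfy the Weyl relation \<open>U s V s = exp (- i s\<^sup>2 D) V s U s\<close> with \<open>D = a\<^sub>1 b\<^sub>2 - a\<^sub>2 b\<^sub>1\<close>, so
  \<open>(exp (- i s\<^sup>2 D) - 1) \<langle>V s U s H, H\<rangle>
    = \<langle>(V s - 1) H, (U (-s) - 1) H\<rangle> - \<langle>(U s - 1) H, (V (-s) - 1) H\<rangle>\<close>.
  Applying Cauchy--Schwarz on the right, dividing by \<open>s\<^sup>2\<close> and letting \<open>s\<close> tend to \<open>0\<close> gives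
  \<open>\<bar>D\<bar> \<parallel>H\<parallel>\<^sup>2 \<le> 2 \<parallel>(u - m) S\<^sub>A\<parallel> \<parallel>(u - n) S\<^sub>B\<parallel>\<close> for all real \<open>m\<close>, \<open>n\<close>. Working with the unitaries
  instead of their generators avoids every question of differentiability and domains.
\<close>

section \<open>Square-integrable functions\<close>

text \<open>Functions are kept pointwise rather than as classes modulo null sets, and the measure is
  a parameter because both the line and the plane occur below.\<close>

definition sqint :: "'a measure \<Rightarrow> ('a \<Rightarrow> complex) \<Rightarrow> bool" where
  "sqint M x \<longleftrightarrow> x \<in> borel_measurable M \<and> integrable M (\<lambda>p. (cmod (x p))\<^sup>2)"

text \<open>The Bochner integral defaults to 0 when it does not exist, so this is the norm only
  under \<open>sqint\<close>.\<close>

definition l2norm :: "'a measure \<Rightarrow> ('a \<Rightarrow> complex) \<Rightarrow> real" where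
  "l2norm M x = sqrt (\<integral>p. (cmod (x p))\<^sup>2 \<partial>M)"

lemma sqintD:
  assumes "sqint M x"
  shows "x \<in> borel_measurable M" "integrable M (\<lambda>p. (cmod (x p))\<^sup>2)"
  using assms by (auto simp: sqint_def)

lemma l2norm_nonneg: "0 \<le> l2norm M x"
  by (simp add: l2norm_def)

lemma l2norm_sq: "(l2norm M x)\<^sup>2 = (\<integral>p. (cmod (x p))\<^sup>2 \<partial>M)"
  by (simp add: l2norm_def)

lemma sqint_iff_nn_integral:
  assumes "x \<in> borel_measurable M"
  shows "sqint M x \<longleftrightarrow> (\<integral>\<^sup>+p. ennreal ((cmod (x p))\<^sup>2) \<partial>M) < \<infinity>"
  using assms by (auto simp: sqint_def integrable_iff_bounded)

lemma nn_integral_eq_l2norm: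
  assumes "sqint M x"
  shows "(\<integral>\<^sup>+p. ennreal ((cmod (x p))\<^sup>2) \<partial>M) = ennreal ((l2norm M x)\<^sup>2)"
  using assms by (simp add: l2norm_sq sqint_def nn_integral_eq_integral)

lemma cmod_diff_sq_le: "(cmod (a - b))\<^sup>2 \<le> 2 * (cmod a)\<^sup>2 + 2 * (cmod b)\<^sup>2"
proof -
  have "(cmod (a - b))\<^sup>2 \<le> (cmod a + cmod b)\<^sup>2"
    by (intro power_mono norm_triangle_ineq4) auto
  also have "\<dots> \<le> 2 * (cmod a)\<^sup>2 + 2 * (cmod b)\<^sup>2"
    using sum_squares_bound[of "cmod a" "cmod b"] by (simp add: power2_sum)
  finally show ?thesis .
qed

lemma sqint_diff:
  assumes "sqint M x" "sqint M y"
  shows "sqint M (\<lambda>p. x p - y p)"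
proof -
  note [measurable] = assms[THEN sqintD(1)]
  have "integrable M (\<lambda>p. (cmod (x p - y p))\<^sup>2)"
    by (rule Bochner_Integration.integrable_bound
          [of _ "\<lambda>p. 2 * (cmod (x p))\<^sup>2 + 2 * (cmod (y p))\<^sup>2"])
       (use assms[THEN sqintD(2)] cmod_diff_sq_le in auto)
  then show ?thesis by (simp add: sqint_def)
qed

lemma borel_measurable_cnj [measurable]: "cnj \<in> borel_measurable borel"
  by (intro borel_measurable_continuous_onI continuous_intros)

lemma sqint_mult_integrable:
  assumes "sqint M x" "sqint M y"
  shows "integrable M (\<lambda>p. x p * cnj (y p))"
proof -
  note [measurable] = assms[THEN sqintD(1)]
  have "cmod (x p * cnj (y p)) \<le> (cmod (x p))\<^sup>2 + (cmod (y p))\<^sup>2" for p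
    using sum_squares_bound[of "cmod (x p)" "cmod (y p)"]
      mult_nonneg_nonneg[OF norm_ge_zero[of "x p"] norm_ge_zero[of "y p"]]
    unfolding norm_mult complex_mod_cnj by linarith
  then show ?thesis
    by (intro Bochner_Integration.integrable_bound
          [OF Bochner_Integration.integrable_add[OF assms[THEN sqintD(2)]]]) auto
qed

text \<open>The inequality for nonnegative extended integrals is applied to the moduli;
  integrability of the product brings it back to real numbers.\<close>

lemma Cauchy_Schwarz_sqint:
  assumes "sqint M x" "sqint M y"
  shows "cmod (\<integral>p. x p * cnj (y p) \<partial>M) \<le> l2norm M x * l2norm M y"
proof -
  note [measurable] = assms[THEN sqintD(1)]
  have int: "integrable M (\<lambda>p. cmod (x p) * cmod (y p))"
    using integrable_norm[OF sqint_mult_integrable[OF assms]] by (simp add: norm_mult)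
  have "ennreal ((\<integral>p. cmod (x p) * cmod (y p) \<partial>M)\<^sup>2)
      = (\<integral>\<^sup>+p. ennreal (cmod (x p)) * ennreal (cmod (y p)) \<partial>M)\<^sup>2"
    using nn_integral_eq_integral[OF int] by (simp add: ennreal_mult ennreal_power)
  also have "\<dots> \<le> (\<integral>\<^sup>+p. (ennreal (cmod (x p)))\<^sup>2 \<partial>M) * (\<integral>\<^sup>+p. (ennreal (cmod (y p)))\<^sup>2 \<partial>M)"
    by (rule Cauchy_Schwarz_nn_integral) auto
  also have "\<dots> = ennreal ((l2norm M x * l2norm M y)\<^sup>2)"
    using assms[THEN nn_integral_eq_l2norm]
    by (simp add: ennreal_power power_mult_distrib ennreal_mult)
  finally have "(\<integral>p. cmod (x p) * cmod (y p) \<partial>M)\<^sup>2 \<le> (l2norm M x * l2norm M y)\<^sup>2"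
    by (subst (asm) ennreal_le_iff) auto
  then have "(\<integral>p. cmod (x p) * cmod (y p) \<partial>M) \<le> l2norm M x * l2norm M y"
    by (rule power2_le_imp_le) (simp add: l2norm_nonneg)
  moreover have "cmod (\<integral>p. x p * cnj (y p) \<partial>M) \<le> (\<integral>p. cmod (x p) * cmod (y p) \<partial>M)"
    using integral_norm_bound[of M "\<lambda>p. x p * cnj (y p)"] by (simp add: norm_mult)
  ultimately show ?thesis by linarith
qed

section \<open>Translation invariance of Lebesgue measure\<close>

lemma nn_integral_shift:
  fixes c :: "'a :: euclidean_space"
  assumes [measurable]: "w \<in> borel_measurable borel"
  shows "(\<integral>\<^sup>+x. w (x + c) \<partial>lborel) = (\<integral>\<^sup>+x. w x \<partial>lborel)"
proof -
  have "(\<integral>\<^sup>+x. w x \<partial>lborel) = (\<integral>\<^sup>+x. w x \<partial>distr lborel borel ((+) c))"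
    by (simp add: lborel_distr_plus)
  also have "\<dots> = (\<integral>\<^sup>+x. w (c + x) \<partial>lborel)"
    by (subst nn_integral_distr) auto
  finally show ?thesis by (simp add: add.commute)
qed

lemma integral_shift:
  fixes c :: "'a :: euclidean_space" and w :: "'a \<Rightarrow> 'b :: {banach, second_countable_topology}"
  assumes [measurable]: "w \<in> borel_measurable borel"
  shows "(\<integral>x. w (x + c) \<partial>lborel) = (\<integral>x. w x \<partial>lborel)"
proof -
  have "(\<integral>x. w x \<partial>lborel) = (\<integral>x. w x \<partial>distr lborel borel ((+) c))"
    by (simp add: lborel_distr_plus)
  also have "\<dots> = (\<integral>x. w (c + x) \<partial>lborel)"
    by (subst integral_distr) auto
  finally show ?thesis by (simp add: add.commute)
qed

lemma integrable_shift:
  fixes c :: "'a :: euclidean_space" and w :: "'a \<Rightarrow> 'b :: {banach, second_countable_topology}"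
  assumes "integrable lborel w"
  shows "integrable lborel (\<lambda>x. w (x + c))"
proof -
  have "integrable (distr lborel borel ((+) c)) w"
    using assms by (simp add: lborel_distr_plus)
  then show ?thesis
    using assms by (subst (asm) integrable_distr_eq) (auto simp: add.commute)
qed

section \<open>Continuity of translations in the mean\<close>

text \<open>A point of an open set stays in it under all sufficiently small shifts, so the integrand
  tends to 0 pointwise; the indicator of \<open>U\<close> dominates it.\<close>

lemma nn_integral_indicator_shift_open:
  fixes U :: "real set"
  assumes "open U" "emeasure lborel U < \<infinity>" "z \<longlonglongrightarrow> 0"
  shows "(\<lambda>n. \<integral>\<^sup>+x. indicator U x * indicator (- U) (x + z n) \<partial>lborel) \<longlonglongrightarrow> 0"
proof -
  have [measurable]: "U \<in> sets borel" using assms by auto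
  have [measurable]: "- U \<in> sets borel"
    using assms(1) by (intro borel_closed) auto
  have "(\<lambda>n. \<integral>\<^sup>+x. indicator U x * indicator (- U) (x + z n) \<partial>lborel)
      \<longlonglongrightarrow> (\<integral>\<^sup>+x. 0 \<partial>(lborel :: real measure))"
  proof (rule nn_integral_dominated_convergence[where w="\<lambda>x. indicator U x"])
    show "AE x in lborel. indicator U x * indicator (- U) (x + z j) \<le> (indicator U x :: ennreal)" for j
      by (auto split: split_indicator)
    show "(\<integral>\<^sup>+ x. indicator U x \<partial>lborel) < \<infinity>"
      using assms by simp
    show "AE x in lborel. (\<lambda>i. indicator U x * indicator (- U) (x + z i)) \<longlonglongrightarrow> (0::ennreal)"
    proof (intro AE_I2)
      fix x :: real
      show "(\<lambda>i. indicator U x * indicator (- U) (x + z i)) \<longlonglongrightarrow> (0::ennreal)"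
      proof (cases "x \<in> U")
        case True
        have "(\<lambda>i. x + z i) \<longlonglongrightarrow> x + 0" by (intro tendsto_intros assms)
        then have "eventually (\<lambda>i. x + z i \<in> U) sequentially"
          using True assms(1) by (auto dest: topological_tendstoD)
        then show ?thesis
          by (intro tendsto_eventually) (auto elim!: eventually_mono split: split_indicator)
      qed auto
    qed
  qed auto
  then show ?thesis by simp
qed

text \<open>Continuity at 0 of translation in the mean-square sense. The sequential form suits
  dominated convergence, and the nonnegative integral makes sense before integrability is
  known.\<close>

definition transl_continuous :: "(real \<Rightarrow> complex) \<Rightarrow> bool" where
  "transl_continuous k \<longleftrightarrow> (\<forall>z. z \<longlonglongrightarrow> 0 \<longrightarrow>
     (\<lambda>n. \<integral>\<^sup>+x. ennreal ((cmod (k (x + z n) - k x))\<^sup>2) \<partial>lborel) \<longlonglongrightarrow> 0)"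

lemma ennreal_tendsto_0I:
  fixes F :: "nat \<Rightarrow> ennreal"
  assumes "\<And>e::real. 0 < e \<Longrightarrow> eventually (\<lambda>n. F n \<le> ennreal e) sequentially"
  shows "F \<longlonglongrightarrow> 0"
proof (rule order_tendstoI)
  fix a :: ennreal assume "0 < a"
  then obtain a' where a': "0 < a'" "a' < a" using dense by blast
  then obtain e :: real where e: "0 < e" "ennreal e < a"
    by (cases a') (auto simp: top_unique)
  show "eventually (\<lambda>n. F n < a) sequentially"
    using assms[OF e(1)] by eventually_elim (use e(2) in auto)
qed simp

lemma ennreal_tendsto_0D:
  fixes F :: "nat \<Rightarrow> ennreal"
  assumes "F \<longlonglongrightarrow> 0" "0 < (e::real)"
  shows "eventually (\<lambda>n. F n < ennreal e) sequentially"
  using order_tendstoD(2)[OF assms(1), of "ennreal e"] assms(2) by simp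

text \<open>Outer regularity replaces \<open>A\<close> by a slightly larger open \<open>U\<close>.
  Where the indicator of \<open>A\<close> changes under the shift, either the shift crosses the
  boundary of \<open>U\<close> or one of the two points lies in \<open>U - A\<close>.\<close>

lemma transl_continuous_indicator:
  fixes A :: "real set" and y :: complex
  assumes A[measurable]: "A \<in> sets borel" and fin: "emeasure lborel A < \<infinity>"
  shows "transl_continuous (\<lambda>x. indicator A x *\<^sub>R y)"
  unfolding transl_continuous_def
proof (intro allI impI)
  fix z :: "nat \<Rightarrow> real" assume z: "z \<longlonglongrightarrow> 0"
  let ?I = "\<lambda>n. \<integral>\<^sup>+x. ennreal \<bar>indicat_real A (x + z n) - indicat_real A x\<bar> \<partial>lborel"
  have "?I \<longlonglongrightarrow> 0"
  proof (rule ennreal_tendsto_0I)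
    fix e :: real assume e: "0 < e"
    \<comment> \<open>The bound consists of four terms, leaving and entering \<open>U\<close> and
      two copies of \<open>U - A\<close>, each allotted \<open>e/4\<close>.\<close>
    obtain U where U: "open U" "A \<subseteq> U" "emeasure lborel (U - A) < ennreal (e/4)"
      using outer_regular_lborel[OF A, of "e/4"] e by auto
    have [measurable]: "U \<in> sets borel" "- U \<in> sets borel" using U by auto
    have Ufin: "emeasure lborel U < \<infinity>"
    proof -
      have "emeasure lborel (A \<union> (U - A)) \<le> emeasure lborel A + emeasure lborel (U - A)"
        by (rule emeasure_subadditive) auto
      moreover have "A \<union> (U - A) = U" using U by auto
      ultimately show ?thesis using U(3) fin
        by (auto simp: ennreal_add_less_top elim!: order_le_less_trans intro: order.strict_trans[OF _ ennreal_less_top])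
    qed
    let ?a = "\<lambda>n. \<integral>\<^sup>+x. indicator U x * indicator (- U) (x + z n) \<partial>lborel"
    let ?b = "\<lambda>n. \<integral>\<^sup>+x. indicator U x * indicator (- U) (x + - z n) \<partial>lborel"
    have le: "?I n \<le> ?a n + ?b n + (ennreal (e/4) + ennreal (e/4))" for n
    proof -
      have "?I n \<le> (\<integral>\<^sup>+x. (indicator U x * indicator (- U) (x + z n)
            + indicator U (x + z n) * indicator (- U) x)
            + (indicator (U - A) (x + z n) + indicator (U - A) x) \<partial>lborel)"
        by (rule nn_integral_mono) (use U(2) in \<open>auto split: split_indicator\<close>)
      also have "\<dots> = ?a n + (\<integral>\<^sup>+x. indicator U (x + z n) * indicator (- U) x \<partial>lborel)
           + ((\<integral>\<^sup>+x. indicator (U - A) (x + z n) \<partial>lborel) + (\<integral>\<^sup>+x. indicator (U - A) x \<partial>lborel))"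
        by (simp add: nn_integral_add)
      \<comment> \<open>Entering \<open>U\<close> under the shift \<open>z n\<close> is leaving
        \<open>U\<close> under \<open>- z n\<close>, so the previous lemma covers this term
        too.\<close>
      also have "(\<integral>\<^sup>+x. indicator U (x + z n) * indicator (- U) x \<partial>lborel) = ?b n"
        using nn_integral_shift[of "\<lambda>x. indicator U x * indicator (- U) (x + - z n)" "z n"] by simp
      also have "(\<integral>\<^sup>+x. indicator (U - A) (x + z n) \<partial>lborel) = emeasure lborel (U - A)"
        using nn_integral_shift[of "indicator (U - A)" "z n"] by simp
      also have "(\<integral>\<^sup>+x. indicator (U - A) x \<partial>lborel) = emeasure lborel (U - A)"
        by simp
      finally show ?thesis
        using U(3) by (elim order_trans) (intro add_mono order_refl less_imp_le)
    qed
    have "eventually (\<lambda>n. ?a n < ennreal (e/4)) sequentially"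
      using e by (intro ennreal_tendsto_0D nn_integral_indicator_shift_open U Ufin z) auto
    moreover have "eventually (\<lambda>n. ?b n < ennreal (e/4)) sequentially"
      using e tendsto_minus[OF z] by (intro ennreal_tendsto_0D nn_integral_indicator_shift_open U Ufin) auto
    ultimately show "eventually (\<lambda>n. ?I n \<le> ennreal e) sequentially"
    proof eventually_elim
      case (elim n)
      have "?I n \<le> ennreal (e/4) + ennreal (e/4) + (ennreal (e/4) + ennreal (e/4))"
        using elim by (intro order_trans[OF le] add_mono order_refl less_imp_le)
      also have "\<dots> = ennreal e" using e by (simp flip: ennreal_plus)
      finally show ?case .
    qed
  qed
  then have "(\<lambda>n. ennreal ((cmod y)\<^sup>2) * ?I n) \<longlonglongrightarrow> ennreal ((cmod y)\<^sup>2) * 0"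
    by (intro ennreal_tendsto_cmult) auto
  \<comment> \<open>A difference of indicators takes only the values -1, 0 and 1, so its square is
    its absolute value.\<close>
  moreover have "(\<integral>\<^sup>+x. ennreal ((cmod (indicator A (x + z n) *\<^sub>R y - indicator A x *\<^sub>R y))\<^sup>2) \<partial>lborel)
      = ennreal ((cmod y)\<^sup>2) * ?I n" for n
    by (subst nn_integral_cmult[symmetric])
       (auto intro!: nn_integral_cong split: split_indicator simp: ennreal_mult)
  ultimately show "(\<lambda>n. \<integral>\<^sup>+x. ennreal ((cmod (indicator A (x + z n) *\<^sub>R y - indicator A x *\<^sub>R y))\<^sup>2) \<partial>lborel)
      \<longlonglongrightarrow> 0" by simp
qed

lemma transl_continuous_add:
  assumes "transl_continuous k" "transl_continuous l"
    and [measurable]: "k \<in> borel_measurable borel" "l \<in> borel_measurable borel"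
  shows "transl_continuous (\<lambda>x. k x + l x)"
  unfolding transl_continuous_def
proof (intro allI impI)
  fix z :: "nat \<Rightarrow> real" assume z: "z \<longlonglongrightarrow> 0"
  let ?a = "\<lambda>n. \<integral>\<^sup>+x. ennreal ((cmod (k (x + z n) - k x))\<^sup>2) \<partial>lborel"
  let ?b = "\<lambda>n. \<integral>\<^sup>+x. ennreal ((cmod (l (x + z n) - l x))\<^sup>2) \<partial>lborel"
  let ?c = "\<lambda>n. \<integral>\<^sup>+x. ennreal ((cmod (k (x + z n) + l (x + z n) - (k x + l x)))\<^sup>2) \<partial>lborel"
  have "?a \<longlonglongrightarrow> 0" "?b \<longlonglongrightarrow> 0"
    using assms z by (auto simp: transl_continuous_def)
  then have lim: "(\<lambda>n. 2 * ?a n + 2 * ?b n) \<longlonglongrightarrow> 2 * 0 + 2 * 0"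
    by (intro tendsto_add ennreal_tendsto_cmult) auto
  have "?c n \<le> 2 * ?a n + 2 * ?b n" for n
  proof -
    have "(cmod (k (x + z n) + l (x + z n) - (k x + l x)))\<^sup>2
      \<le> 2 * (cmod (k (x + z n) - k x))\<^sup>2 + 2 * (cmod (l (x + z n) - l x))\<^sup>2" for x
      using cmod_diff_sq_le[of "k (x + z n) - k x" "- (l (x + z n) - l x)"]
      by (simp add: algebra_simps norm_minus_commute)
    then have "?c n \<le> (\<integral>\<^sup>+x. 2 * ennreal ((cmod (k (x + z n) - k x))\<^sup>2)
         + 2 * ennreal ((cmod (l (x + z n) - l x))\<^sup>2) \<partial>lborel)"
      by (intro nn_integral_mono)
         (simp flip: ennreal_numeral ennreal_plus ennreal_mult)
    also have "\<dots> = 2 * ?a n + 2 * ?b n"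
      by (simp add: nn_integral_add nn_integral_cmult)
    finally show ?thesis .
  qed
  then show "?c \<longlonglongrightarrow> 0"
    using lim by (intro tendsto_sandwich[of "\<lambda>_. 0" ?c sequentially "\<lambda>n. 2 * ?a n + 2 * ?b n" 0]) auto
qed

lemma transl_continuous_simple:
  fixes k :: "real \<Rightarrow> complex"
  assumes "simple_function lborel k" "emeasure lborel {x \<in> space lborel. k x \<noteq> 0} \<noteq> \<infinity>"
  shows "transl_continuous k"
  using assms
proof (induction rule: integrable_simple_function_induct)
  case (cong f g)
  then have "f = g" by (intro ext) auto
  then show ?case using cong by simp
next
  case (indicator A y)
  then show ?case
    by (intro transl_continuous_indicator) (auto simp: less_top)
next
  case (add f g)
  then show ?case
    using add(1,3)[THEN borel_measurable_simple_function]
    by (intro transl_continuous_add) auto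
qed

text \<open>The factor 4 is crude but symmetric: the two-term bound is used twice.\<close>

lemma nn_integral_cmod_three:
  assumes [measurable]: "x \<in> borel_measurable M" "y \<in> borel_measurable M" "w \<in> borel_measurable M"
  shows "(\<integral>\<^sup>+p. ennreal ((cmod (x p + y p + w p))\<^sup>2) \<partial>M)
    \<le> 4 * (\<integral>\<^sup>+p. ennreal ((cmod (x p))\<^sup>2) \<partial>M) + 4 * (\<integral>\<^sup>+p. ennreal ((cmod (y p))\<^sup>2) \<partial>M)
      + 4 * (\<integral>\<^sup>+p. ennreal ((cmod (w p))\<^sup>2) \<partial>M)" (is "?l \<le> ?r")
proof -
  have "(cmod (a + b + c))\<^sup>2 \<le> 4 * (cmod a)\<^sup>2 + 4 * (cmod b)\<^sup>2 + 4 * (cmod c)\<^sup>2" for a b c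
    using cmod_diff_sq_le[of "a + b" "- c"] cmod_diff_sq_le[of a "- b"]
      zero_le_power2[of "cmod c"] unfolding diff_minus_eq_add norm_minus_cancel by linarith
  then have "?l \<le> (\<integral>\<^sup>+p. 4 * ennreal ((cmod (x p))\<^sup>2) + 4 * ennreal ((cmod (y p))\<^sup>2)
      + 4 * ennreal ((cmod (w p))\<^sup>2) \<partial>M)"
    by (intro nn_integral_mono) (simp flip: ennreal_numeral ennreal_plus ennreal_mult)
  also have "\<dots> = ?r"
    by (simp add: nn_integral_add nn_integral_cmult)
  finally show ?thesis .
qed

text \<open>Density argument: a simple function close to \<open>k\<close> in mean square has the
  property, and by translation invariance the approximation error is the same before and after the
  shift.\<close>

lemma transl_continuous_sqint:
  assumes k: "sqint lborel k"
  shows "transl_continuous k"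
  unfolding transl_continuous_def
proof (intro allI impI ennreal_tendsto_0I)
  fix z :: "nat \<Rightarrow> real" and e :: real assume z: "z \<longlonglongrightarrow> 0" and e: "0 < e"
  have kb: "k \<in> borel_measurable lborel" and [measurable]: "k \<in> borel_measurable borel"
    using k by (auto simp: sqint_def)
  obtain s where s: "\<And>i. simple_function lborel (s i)" "\<And>x. (\<lambda>i. s i x) \<longlonglongrightarrow> k x"
      "\<And>i x. dist (s i x) 0 \<le> 2 * dist (k x) 0"
    using borel_measurable_implies_sequence_metric[OF kb, of 0] by (auto simp: space_lborel)
  have [measurable]: "s i \<in> borel_measurable borel" for i
    using borel_measurable_simple_function[OF s(1)[of i]] by simp
  have kfin: "(\<integral>\<^sup>+x. ennreal ((cmod (k x))\<^sup>2) \<partial>lborel) < \<infinity>"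
    using k kb sqint_iff_nn_integral by blast
  have "(\<lambda>i. \<integral>\<^sup>+x. ennreal ((cmod (s i x - k x))\<^sup>2) \<partial>lborel)
      \<longlonglongrightarrow> (\<integral>\<^sup>+x. 0 \<partial>(lborel :: real measure))"
  \<comment> \<open>Since \<open>s j\<close> is at most twice \<open>k\<close> in modulus, the
    two-term bound gives 2 * 4 + 2 = 10.\<close>
  proof (rule nn_integral_dominated_convergence[where w="\<lambda>x. 10 * ennreal ((cmod (k x))\<^sup>2)"])
    show "AE x in lborel. ennreal ((cmod (s j x - k x))\<^sup>2) \<le> 10 * ennreal ((cmod (k x))\<^sup>2)" for j
    proof (intro AE_I2)
      fix x
      have "(cmod (s j x))\<^sup>2 \<le> (2 * cmod (k x))\<^sup>2"
        using s(3)[of j x] by (intro power_mono) auto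
      then have "(cmod (s j x - k x))\<^sup>2 \<le> 10 * (cmod (k x))\<^sup>2"
        using cmod_diff_sq_le[of "s j x" "k x"] by (simp add: power_mult_distrib)
      then show "ennreal ((cmod (s j x - k x))\<^sup>2) \<le> 10 * ennreal ((cmod (k x))\<^sup>2)"
        by (simp flip: ennreal_numeral ennreal_mult)
    qed
    show "(\<integral>\<^sup>+x. 10 * ennreal ((cmod (k x))\<^sup>2) \<partial>lborel) < \<infinity>"
      using kfin by (simp add: nn_integral_cmult ennreal_mult_less_top)
    show "AE x in lborel. (\<lambda>i. ennreal ((cmod (s i x - k x))\<^sup>2)) \<longlonglongrightarrow> 0"
    proof (intro AE_I2)
      fix x
      have "(\<lambda>i. ennreal ((cmod (s i x - k x))\<^sup>2)) \<longlonglongrightarrow> ennreal ((cmod (k x - k x))\<^sup>2)"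
        by (intro tendsto_intros tendsto_ennrealI s)
      then show "(\<lambda>i. ennreal ((cmod (s i x - k x))\<^sup>2)) \<longlonglongrightarrow> 0" by simp
    qed
  qed auto
  \<comment> \<open>Three terms, each weighted by 4, must add up to \<open>e\<close>.\<close>
  then have "eventually (\<lambda>i. (\<integral>\<^sup>+x. ennreal ((cmod (s i x - k x))\<^sup>2) \<partial>lborel) < ennreal (e/12)) sequentially"
    using e by (intro ennreal_tendsto_0D) auto
  then obtain i where i: "(\<integral>\<^sup>+x. ennreal ((cmod (s i x - k x))\<^sup>2) \<partial>lborel) < ennreal (e/12)"
    by (auto simp: eventually_sequentially)
  have "transl_continuous (s i)"
  proof (rule transl_continuous_simple[OF s(1)])
    have "integrable lborel (\<lambda>x. (cmod (s i x))\<^sup>2)"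
    proof (rule Bochner_Integration.integrable_bound)
      show "integrable lborel (\<lambda>x. 4 * (cmod (k x))\<^sup>2)" using k by (simp add: sqint_def)
      show "AE x in lborel. norm ((cmod (s i x))\<^sup>2) \<le> norm (4 * (cmod (k x))\<^sup>2)"
      proof (intro AE_I2)
        fix x
        have "(cmod (s i x))\<^sup>2 \<le> (2 * cmod (k x))\<^sup>2"
          using s(3)[of i x] by (intro power_mono) auto
        then show "norm ((cmod (s i x))\<^sup>2) \<le> norm (4 * (cmod (k x))\<^sup>2)"
          by (simp add: power_mult_distrib)
      qed
    qed simp
    \<comment> \<open>The square of the modulus is an integrable simple function with the same
      support as \<open>s i\<close>, which forces that support to have finite measure.\<close>
    moreover have "simple_function lborel (\<lambda>x. (cmod (s i x))\<^sup>2)"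
      by (rule simple_function_compose1[OF s(1)])
    ultimately have "Bochner_Integration.simple_bochner_integrable lborel (\<lambda>x. (cmod (s i x))\<^sup>2)"
      by (intro simple_bochner_integrableI_bounded[of lborel "\<lambda>x. (cmod (s i x))\<^sup>2"])
         (auto simp: integrable_iff_bounded)
    then show "emeasure lborel {x \<in> space lborel. s i x \<noteq> 0} \<noteq> \<infinity>"
      by (auto elim!: Bochner_Integration.simple_bochner_integrable.cases)
  qed
  then have "(\<lambda>n. \<integral>\<^sup>+x. ennreal ((cmod (s i (x + z n) - s i x))\<^sup>2) \<partial>lborel) \<longlonglongrightarrow> 0"
    using z by (auto simp: transl_continuous_def)
  then have "eventually (\<lambda>n. (\<integral>\<^sup>+x. ennreal ((cmod (s i (x + z n) - s i x))\<^sup>2) \<partial>lborel) < ennreal (e/12)) sequentially"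
    using e by (intro ennreal_tendsto_0D) auto
  then show "eventually (\<lambda>n. (\<integral>\<^sup>+x. ennreal ((cmod (k (x + z n) - k x))\<^sup>2) \<partial>lborel) \<le> ennreal e) sequentially"
  proof eventually_elim
    case (elim n)
    have "(\<integral>\<^sup>+x. ennreal ((cmod (k (x + z n) - k x))\<^sup>2) \<partial>lborel)
       = (\<integral>\<^sup>+x. ennreal ((cmod ((k (x + z n) - s i (x + z n)) + (s i (x + z n) - s i x) + (s i x - k x)))\<^sup>2) \<partial>lborel)"
      by simp
    also have "\<dots> \<le> 4 * (\<integral>\<^sup>+x. ennreal ((cmod (k (x + z n) - s i (x + z n)))\<^sup>2) \<partial>lborel)
        + 4 * (\<integral>\<^sup>+x. ennreal ((cmod (s i (x + z n) - s i x))\<^sup>2) \<partial>lborel)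
        + 4 * (\<integral>\<^sup>+x. ennreal ((cmod (s i x - k x))\<^sup>2) \<partial>lborel)"
      by (rule nn_integral_cmod_three) auto
    also have "(\<integral>\<^sup>+x. ennreal ((cmod (k (x + z n) - s i (x + z n)))\<^sup>2) \<partial>lborel)
        = (\<integral>\<^sup>+x. ennreal ((cmod (s i x - k x))\<^sup>2) \<partial>lborel)"
      using nn_integral_shift[of "\<lambda>x. ennreal ((cmod (s i x - k x))\<^sup>2)" "z n"]
      by (simp add: norm_minus_commute)
    also have "4 * (\<integral>\<^sup>+x. ennreal ((cmod (s i x - k x))\<^sup>2) \<partial>lborel)
        + 4 * (\<integral>\<^sup>+x. ennreal ((cmod (s i (x + z n) - s i x))\<^sup>2) \<partial>lborel)
        + 4 * (\<integral>\<^sup>+x. ennreal ((cmod (s i x - k x))\<^sup>2) \<partial>lborel)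
       \<le> 4 * ennreal (e/12) + 4 * ennreal (e/12) + 4 * ennreal (e/12)"
      using i elim by (intro add_mono mult_left_mono less_imp_le) auto
    also have "\<dots> = ennreal e"
      using e by (simp flip: ennreal_numeral ennreal_mult ennreal_plus)
    finally show ?case .
  qed
qed

section \<open>Plancherel's theorem\<close>

text \<open>Angular frequency without normalisation; the factor \<open>2 * pi\<close> therefore
  appears in \<open>Plancherel\<close>.\<close>

definition ft :: "(real \<Rightarrow> complex) \<Rightarrow> real \<Rightarrow> complex" where
  "ft k w = (\<integral>t. k t * iexp (- (t * w)) \<partial>lborel)"

text \<open>Its Fourier transform is the squared modulus of \<open>ft k\<close> and its value at 0
  is the squared norm of \<open>k\<close>, so Plancherel amounts to Fourier inversion of
  \<open>autocorr k\<close> at the origin.\<close>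

definition autocorr :: "(real \<Rightarrow> complex) \<Rightarrow> real \<Rightarrow> complex" where
  "autocorr k z = (\<integral>y. k (y + z) * cnj (k y) \<partial>lborel)"

lemma borel_measurable_iexp [measurable]: "iexp \<in> borel_measurable borel"
  by (intro borel_measurable_continuous_onI continuous_intros)

lemma cnj_iexp: "cnj (iexp x) = iexp (- x)"
  by (simp add: exp_cnj)

lemma iexp_add: "iexp (x + y) = iexp x * iexp y"
  by (simp add: exp_add ring_distribs)

lemma integrable_mult_iexp:
  assumes k: "integrable M k" and [measurable]: "h \<in> borel_measurable M"
  shows "integrable M (\<lambda>x. k x * iexp (h x))"
proof (rule Bochner_Integration.integrable_bound[OF k])
  note [measurable] = borel_measurable_integrable[OF k]
  show "(\<lambda>x. k x * iexp (h x)) \<in> borel_measurable M" by measurable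
qed (simp add: norm_mult)

lemma borel_measurable_ft [measurable]:
  assumes [measurable]: "k \<in> borel_measurable borel"
  shows "ft k \<in> borel_measurable borel"
  unfolding ft_def by measurable

text \<open>By translation invariance the modulus integrates to the square of the integral of
  \<open>cmod (k y)\<close>. The case \<open>w = 0\<close> makes \<open>autocorr k\<close>
  integrable; general \<open>w\<close> justifies the exchange of integrals in its transform.\<close>

lemma integrable_autocorr_aux:
  assumes k: "integrable lborel k"
  shows "integrable (lborel \<Otimes>\<^sub>M lborel) (\<lambda>(y,z). k (y + z) * cnj (k y) * iexp (- (z * w)))"
proof (rule lborel_pair.Fubini_integrable)
  have [measurable]: "k \<in> borel_measurable borel" using borel_measurable_integrable[OF k] by simp
  show "(\<lambda>(y,z). k (y + z) * cnj (k y) * iexp (- (z * w))) \<in> borel_measurable (lborel \<Otimes>\<^sub>M lborel)"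
    by measurable
  have k': "integrable lborel (\<lambda>z. k (y + z))" for y
    using integrable_shift[OF k, of y] by (simp add: add.commute)
  have "(\<integral>z. cmod (k (y + z)) \<partial>lborel) = (\<integral>z. cmod (k z) \<partial>lborel)" for y
    using integral_shift[of "\<lambda>z. cmod (k z)" y] by (simp add: add.commute)
  then have "(\<integral>z. norm (k (y + z) * cnj (k y) * iexp (- (z * w))) \<partial>lborel)
      = cmod (k y) * (\<integral>z. cmod (k z) \<partial>lborel)" for y
    by (simp add: norm_mult mult.commute)
  then show "integrable lborel (\<lambda>y. \<integral>z. norm (case (y, z) of (y, z) \<Rightarrow>
      k (y + z) * cnj (k y) * iexp (- (z * w))) \<partial>lborel)"
    using k by simp
  show "AE y in lborel. integrable lborel (\<lambda>z. case (y, z) of (y, z) \<Rightarrow>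
      k (y + z) * cnj (k y) * iexp (- (z * w)))"
    unfolding prod.case using k'
    by (intro AE_I2 integrable_mult_iexp[of lborel _ "\<lambda>z. - (z * w)"] integrable_mult_left) auto
qed

lemma integrable_autocorr:
  assumes "integrable lborel k"
  shows "integrable lborel (autocorr k)"
  using lborel_pair.integrable_snd[OF integrable_autocorr_aux[OF assms, of 0]]
  by (simp add: autocorr_def[abs_def])

text \<open>After exchanging the integrals, the phase splits as
  \<open>- (z * w) = y * w - (z + y) * w\<close>, which separates the double integral into
  \<open>ft k w\<close> and its conjugate.\<close>

lemma ft_autocorr:
  assumes k: "integrable lborel k"
  shows "ft (autocorr k) w = complex_of_real ((cmod (ft k w))\<^sup>2)"
proof -
  have [measurable]: "k \<in> borel_measurable borel" using borel_measurable_integrable[OF k] by simp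
  have inner: "(\<integral>z. k (y + z) * cnj (k y) * iexp (- (z * w)) \<partial>lborel)
      = cnj (k y * iexp (- (y * w))) * ft k w" for y
  proof -
    have "(\<integral>z. k (y + z) * cnj (k y) * iexp (- (z * w)) \<partial>lborel)
        = (\<integral>z. cnj (k y * iexp (- (y * w))) * (k (z + y) * iexp (- ((z + y) * w))) \<partial>lborel)"
    proof (rule Bochner_Integration.integral_cong[OF refl])
      fix z
      have "iexp (- (z * w)) = cnj (iexp (- (y * w))) * iexp (- ((z + y) * w))"
        unfolding cnj_iexp iexp_add[symmetric] by (simp add: algebra_simps)
      then show "k (y + z) * cnj (k y) * iexp (- (z * w))
          = cnj (k y * iexp (- (y * w))) * (k (z + y) * iexp (- ((z + y) * w)))"
        by (simp add: add.commute mult_ac)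
    qed
    also have "\<dots> = cnj (k y * iexp (- (y * w))) * (\<integral>z. k (z + y) * iexp (- ((z + y) * w)) \<partial>lborel)"
      by simp
    also have "(\<integral>z. k (z + y) * iexp (- ((z + y) * w)) \<partial>lborel) = ft k w"
      unfolding ft_def by (rule integral_shift) measurable
    finally show ?thesis .
  qed
  have "ft (autocorr k) w = (\<integral>z. (\<integral>y. k (y + z) * cnj (k y) * iexp (- (z * w)) \<partial>lborel) \<partial>lborel)"
    by (simp add: ft_def autocorr_def)
  also have "\<dots> = (\<integral>y. (\<integral>z. k (y + z) * cnj (k y) * iexp (- (z * w)) \<partial>lborel) \<partial>lborel)"
    by (rule lborel_pair.Fubini_integral[OF integrable_autocorr_aux[OF k]])
  also have "\<dots> = (\<integral>y. cnj (k y * iexp (- (y * w))) * ft k w \<partial>lborel)"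
    by (simp only: inner)
  also have "\<dots> = (\<integral>y. cnj (k y * iexp (- (y * w))) \<partial>lborel) * ft k w"
    by (rule integral_mult_left_zero)
  also have "(\<integral>y. cnj (k y * iexp (- (y * w))) \<partial>lborel) = cnj (ft k w)"
    unfolding ft_def by (rule Bochner_Integration.integral_cnj)
  also have "cnj (ft k w) * ft k w = complex_of_real ((cmod (ft k w))\<^sup>2)"
    by (simp only: complex_norm_square mult.commute)
  finally show ?thesis .
qed

section \<open>Gaussian regularisation of Fourier inversion at the origin\<close>

text \<open>This is the characteristic function of the standard normal distribution after the
  substitution \<open>x = s * w\<close>.\<close>

lemma gaussian_ft:
  assumes s: "0 < s"
  shows "(\<integral>w. complex_of_real (std_normal_density (s * w)) * iexp (- (z * w)) \<partial>lborel)
       = complex_of_real (sqrt (2 * pi) / s * std_normal_density (z / s))"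
proof -
  have "complex_of_real (exp (- (- z / s)\<^sup>2 / 2)) = char std_normal_distribution (- z / s)"
    by (simp add: char_std_normal_distribution)
  also have "\<dots> = (\<integral>x. std_normal_density x *\<^sub>R iexp (- z / s * x) \<partial>lborel)"
    unfolding char_def by (subst integral_density) auto
  also have "\<dots> = \<bar>s\<bar> *\<^sub>R (\<integral>x. std_normal_density (0 + s * x) *\<^sub>R iexp (- z / s * (0 + s * x)) \<partial>lborel)"
    using s by (intro lborel_integral_real_affine) auto
  also have "\<dots> = s *\<^sub>R (\<integral>w. complex_of_real (std_normal_density (s * w)) * iexp (- (z * w)) \<partial>lborel)"
    using s by (simp add: scaleR_conv_of_real)
  finally have "(\<integral>w. complex_of_real (std_normal_density (s * w)) * iexp (- (z * w)) \<partial>lborel)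
      = complex_of_real (exp (- (- z / s)\<^sup>2 / 2)) / s"
    using s by (simp add: scaleR_conv_of_real field_simps)
  then show ?thesis by (simp add: std_normal_density_def)
qed

text \<open>The Gaussian supplies decay in \<open>w\<close>, where the oscillating factor alone has
  constant modulus; this permits Fubini.\<close>

lemma integrable_regularised_aux:
  assumes c: "integrable lborel c" and s: "0 < s"
  shows "integrable (lborel \<Otimes>\<^sub>M lborel)
    (\<lambda>(z,w). c z * (complex_of_real (std_normal_density (s * w)) * iexp (- (z * w))))"
proof (rule lborel_pair.Fubini_integrable)
  have [measurable]: "c \<in> borel_measurable borel" using borel_measurable_integrable[OF c] by simp
  show "(\<lambda>(z,w). c z * (complex_of_real (std_normal_density (s * w)) * iexp (- (z * w))))
      \<in> borel_measurable (lborel \<Otimes>\<^sub>M lborel)"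
    by measurable
  have "integrable lborel (\<lambda>w. std_normal_density (0 + s * w))"
    using s by (intro lborel_integrable_real_affine) auto
  then have n: "integrable lborel (\<lambda>w. complex_of_real (std_normal_density (s * w)))" by simp
  show "integrable lborel (\<lambda>z. \<integral>w. norm (case (z, w) of (z, w) \<Rightarrow>
      c z * (complex_of_real (std_normal_density (s * w)) * iexp (- (z * w)))) \<partial>lborel)"
    using c by (simp add: norm_mult)
  show "AE z in lborel. integrable lborel (\<lambda>w. case (z, w) of (z, w) \<Rightarrow>
      c z * (complex_of_real (std_normal_density (s * w)) * iexp (- (z * w))))"
    unfolding prod.case using n
    by (intro AE_I2 integrable_mult_right integrable_mult_iexp[of lborel _ "\<lambda>w. - (_ * w)"]) auto
qed

text \<open>Multiplying by a wide Gaussian makes inversion absolutely convergent. Exchanging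
  integrals turns the Gaussian into a narrow one, and rescaling \<open>z\<close> by \<open>s\<close>
  moves the parameter into \<open>autocorr k\<close>, where the limit at 0 can be taken.\<close>

lemma regularised_Plancherel:
  assumes k: "integrable lborel k" and s: "0 < s"
  shows "integrable lborel (\<lambda>w. (cmod (ft k w))\<^sup>2 * std_normal_density (s * w))"
    and "complex_of_real (\<integral>w. (cmod (ft k w))\<^sup>2 * std_normal_density (s * w) \<partial>lborel)
      = sqrt (2 * pi) * (\<integral>z. autocorr k (s * z) * std_normal_density z \<partial>lborel)"
proof -
  note c = integrable_autocorr[OF k]
  note aux = integrable_regularised_aux[OF c s]
  have eq: "(\<integral>z. autocorr k z * (complex_of_real (std_normal_density (s * w)) * iexp (- (z * w))) \<partial>lborel)
     = complex_of_real ((cmod (ft k w))\<^sup>2 * std_normal_density (s * w))" for w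
  proof -
    have "(\<integral>z. autocorr k z * (complex_of_real (std_normal_density (s * w)) * iexp (- (z * w))) \<partial>lborel)
       = (\<integral>z. (autocorr k z * iexp (- (z * w))) * complex_of_real (std_normal_density (s * w)) \<partial>lborel)"
      by (simp only: mult_ac)
    also have "\<dots> = ft (autocorr k) w * complex_of_real (std_normal_density (s * w))"
      unfolding ft_def by (rule integral_mult_left_zero)
    finally show ?thesis by (simp add: ft_autocorr[OF k])
  qed
  have "integrable lborel (\<lambda>w. complex_of_real ((cmod (ft k w))\<^sup>2 * std_normal_density (s * w)))"
    using lborel_pair.integrable_snd[OF aux] by (simp only: eq)
  then show "integrable lborel (\<lambda>w. (cmod (ft k w))\<^sup>2 * std_normal_density (s * w))"
    by (simp only: complex_of_real_integrable_eq)
  have "complex_of_real (\<integral>w. (cmod (ft k w))\<^sup>2 * std_normal_density (s * w) \<partial>lborel)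
      = (\<integral>w. (\<integral>z. autocorr k z * (complex_of_real (std_normal_density (s * w)) * iexp (- (z * w))) \<partial>lborel) \<partial>lborel)"
    by (simp only: eq integral_complex_of_real)
  also have "\<dots> = (\<integral>z. (\<integral>w. autocorr k z * (complex_of_real (std_normal_density (s * w)) * iexp (- (z * w))) \<partial>lborel) \<partial>lborel)"
    by (rule lborel_pair.Fubini_integral[OF aux])
  also have "\<dots> = (\<integral>z. autocorr k z * complex_of_real (sqrt (2 * pi) / s * std_normal_density (z / s)) \<partial>lborel)"
    by (simp only: integral_mult_right_zero gaussian_ft[OF s])
  also have "\<dots> = \<bar>s\<bar> *\<^sub>R (\<integral>z. autocorr k (0 + s * z) *
      complex_of_real (sqrt (2 * pi) / s * std_normal_density ((0 + s * z) / s)) \<partial>lborel)"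
    using s by (intro lborel_integral_real_affine) auto
  also have "\<dots> = \<bar>s\<bar> *\<^sub>R (\<integral>z. complex_of_real (sqrt (2 * pi) / s) * (autocorr k (s * z) * complex_of_real (std_normal_density z)) \<partial>lborel)"
    using s by (intro arg_cong[where f="\<lambda>x. \<bar>s\<bar> *\<^sub>R x"] Bochner_Integration.integral_cong) auto
  also have "\<dots> = sqrt (2 * pi) * (\<integral>z. autocorr k (s * z) * std_normal_density z \<partial>lborel)"
    using s by (simp only: integral_mult_right_zero) (simp add: scaleR_conv_of_real)
  finally show "complex_of_real (\<integral>w. (cmod (ft k w))\<^sup>2 * std_normal_density (s * w) \<partial>lborel)
      = sqrt (2 * pi) * (\<integral>z. autocorr k (s * z) * std_normal_density z \<partial>lborel)" .
qed

section \<open>The autocorrelation at the origin and the limit of the regularisation\<close>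

lemma sqint_shift:
  assumes "sqint lborel x"
  shows "sqint lborel (\<lambda>p. x (p + c))" "l2norm lborel (\<lambda>p. x (p + c)) = l2norm lborel x"
proof -
  have [measurable]: "x \<in> borel_measurable borel" using assms by (simp add: sqint_def)
  show "sqint lborel (\<lambda>p. x (p + c))"
    using integrable_shift[of "\<lambda>p. (cmod (x p))\<^sup>2" c] assms by (simp add: sqint_def)
  show "l2norm lborel (\<lambda>p. x (p + c)) = l2norm lborel x"
    using integral_shift[of "\<lambda>p. (cmod (x p))\<^sup>2" c] by (simp add: l2norm_def)
qed

lemma autocorr_0: "autocorr k 0 = complex_of_real ((l2norm lborel k)\<^sup>2)"
  by (simp only: autocorr_def l2norm_sq add_0_right complex_norm_square[symmetric] integral_complex_of_real)

lemma autocorr_bound: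
  assumes "sqint lborel k"
  shows "cmod (autocorr k z) \<le> (l2norm lborel k)\<^sup>2"
  using Cauchy_Schwarz_sqint[OF sqint_shift(1)[OF assms, of z] assms]
  by (simp add: autocorr_def sqint_shift[OF assms] power2_eq_square)

text \<open>The increment is the inner product of \<open>k (y + z n) - k y\<close> with
  \<open>k y\<close>, so Cauchy-Schwarz reduces it to mean-square continuity of translation.\<close>

lemma autocorr_tendsto_0:
  assumes k: "sqint lborel k" and z: "z \<longlonglongrightarrow> 0"
  shows "(\<lambda>n. autocorr k (z n)) \<longlonglongrightarrow> autocorr k 0"
proof (rule Lim_transform[OF tendsto_const])
  let ?d = "\<lambda>n. l2norm lborel (\<lambda>x. k (x + z n) - k x)"
  have sq: "sqint lborel (\<lambda>x. k (x + z n) - k x)" for n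
    by (intro sqint_diff sqint_shift k)
  have "(\<lambda>n. ennreal ((?d n)\<^sup>2)) \<longlonglongrightarrow> ennreal 0"
    using transl_continuous_sqint[OF k, unfolded transl_continuous_def, rule_format, OF z]
    by (simp add: nn_integral_eq_l2norm[OF sq])
  then have "(\<lambda>n. (?d n)\<^sup>2) \<longlonglongrightarrow> 0"
    by (subst (asm) tendsto_ennreal_iff) auto
  then have "(\<lambda>n. sqrt ((?d n)\<^sup>2)) \<longlonglongrightarrow> sqrt 0" by (rule tendsto_real_sqrt)
  then have d: "(\<lambda>n. ?d n * l2norm lborel k) \<longlonglongrightarrow> 0"
    by (intro tendsto_mult_left_zero) (simp add: l2norm_nonneg)
  show "(\<lambda>n. autocorr k (z n) - autocorr k 0) \<longlonglongrightarrow> 0"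
  proof (rule Lim_null_comparison[OF _ d], intro always_eventually allI)
    fix n
    have "autocorr k (z n) - autocorr k 0 = (\<integral>y. (k (y + z n) - k y) * cnj (k y) \<partial>lborel)"
      using sqint_mult_integrable[OF sqint_shift(1)[OF k, of "z n"] k] sqint_mult_integrable[OF k k]
      by (simp add: autocorr_def left_diff_distrib Bochner_Integration.integral_diff)
    then show "norm (autocorr k (z n) - autocorr k 0) \<le> ?d n * l2norm lborel k"
      using Cauchy_Schwarz_sqint[OF sq[of n] k] by simp
  qed
qed

text \<open>The regularised identity is passed to the limit: monotone convergence on the frequency
  side, where finiteness is still unknown, and dominated convergence on the autocorrelation
  side.\<close>

theorem Plancherel:
  assumes k1: "integrable lborel k" and k2: "sqint lborel k"
  shows "(\<integral>\<^sup>+w. ennreal ((cmod (ft k w))\<^sup>2) \<partial>lborel)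
       = ennreal (2 * pi) * (\<integral>\<^sup>+x. ennreal ((cmod (k x))\<^sup>2) \<partial>lborel)"
proof -
  have [measurable]: "k \<in> borel_measurable borel" using k2 by (simp add: sqint_def)
  have [measurable]: "autocorr k \<in> borel_measurable borel"
    using borel_measurable_integrable[OF integrable_autocorr[OF k1]] by simp
  \<comment> \<open>A decreasing null sequence makes the Gaussian factors increase pointwise to
    \<open>std_normal_density 0\<close>.\<close>
  define s where "s n = 1 / real (Suc n)" for n
  have s_pos: "0 < s n" for n by (simp add: s_def)
  have s_lim: "s \<longlonglongrightarrow> 0"
    unfolding s_def[abs_def] using LIMSEQ_inverse_real_of_nat by (simp add: inverse_eq_divide)
  have s_mono: "s n \<le> s m" if "m \<le> n" for m n
    using that by (simp add: s_def frac_le)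
  let ?F = "\<lambda>n w. ennreal ((cmod (ft k w))\<^sup>2 * std_normal_density (s n * w))"
  have lhs: "(\<lambda>n. \<integral>\<^sup>+w. ?F n w \<partial>lborel) \<longlonglongrightarrow>
      (\<integral>\<^sup>+w. ennreal ((cmod (ft k w))\<^sup>2 * std_normal_density 0) \<partial>lborel)"
  proof (rule nn_integral_LIMSEQ)
    show "incseq ?F"
    proof (intro incseq_SucI le_funI ennreal_leI mult_left_mono)
      fix n w
      have "(s (Suc n) * w)\<^sup>2 \<le> (s n * w)\<^sup>2"
        using s_mono[of n "Suc n"] s_pos[of "Suc n"]
        by (simp add: power_mult_distrib power_mono mult_right_mono)
      then show "std_normal_density (s n * w) \<le> std_normal_density (s (Suc n) * w)"
        by (simp add: std_normal_density_def divide_right_mono)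
    qed auto
    show "?F i \<in> borel_measurable lborel" for i by measurable
    fix w
    have "(\<lambda>i. exp (- (s i * w)\<^sup>2 / 2)) \<longlonglongrightarrow> exp (- (0 * w)\<^sup>2 / 2)"
      by (intro tendsto_intros s_lim) auto
    then have "(\<lambda>i. std_normal_density (s i * w)) \<longlonglongrightarrow> std_normal_density 0"
      unfolding std_normal_density_def by (intro tendsto_mult_left) simp
    then show "(\<lambda>i. ?F i w) \<longlonglongrightarrow> ennreal ((cmod (ft k w))\<^sup>2 * std_normal_density 0)"
      by (intro tendsto_ennrealI tendsto_mult_left)
  qed
  have "(\<lambda>n. (\<integral>z. autocorr k (s n * z) * std_normal_density z \<partial>lborel))
      \<longlonglongrightarrow> (\<integral>z. autocorr k 0 * std_normal_density z \<partial>lborel)"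
  proof (rule integral_dominated_convergence[where w="\<lambda>z. (l2norm lborel k)\<^sup>2 * std_normal_density z"])
    show "AE z in lborel. (\<lambda>n. autocorr k (s n * z) * std_normal_density z)
        \<longlonglongrightarrow> autocorr k 0 * std_normal_density z"
      using s_lim by (intro AE_I2 tendsto_mult_right autocorr_tendsto_0[OF k2] tendsto_mult_left_zero)
    show "AE z in lborel. norm (autocorr k (s n * z) * std_normal_density z)
        \<le> (l2norm lborel k)\<^sup>2 * std_normal_density z" for n
      by (intro AE_I2) (simp add: norm_mult mult_right_mono autocorr_bound[OF k2])
    show "integrable lborel (\<lambda>z. (l2norm lborel k)\<^sup>2 * std_normal_density z)"
      by (intro integrable_mult_right) auto
  qed measurable
  then have "(\<lambda>n. complex_of_real (sqrt (2 * pi)) * (\<integral>z. autocorr k (s n * z) * std_normal_density z \<partial>lborel))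
      \<longlonglongrightarrow> complex_of_real (sqrt (2 * pi)) * (\<integral>z. autocorr k 0 * std_normal_density z \<partial>lborel)"
    by (rule tendsto_mult_left)
  moreover have "(\<integral>z. autocorr k 0 * std_normal_density z \<partial>lborel) = complex_of_real ((l2norm lborel k)\<^sup>2)"
    by (simp only: integral_mult_right_zero integral_complex_of_real autocorr_0) simp
  ultimately have "(\<lambda>n. complex_of_real (\<integral>w. (cmod (ft k w))\<^sup>2 * std_normal_density (s n * w) \<partial>lborel))
      \<longlonglongrightarrow> complex_of_real (sqrt (2 * pi) * (l2norm lborel k)\<^sup>2)"
    by (simp only: regularised_Plancherel(2)[OF k1 s_pos] of_real_mult)
  then have "(\<lambda>n. \<integral>w. (cmod (ft k w))\<^sup>2 * std_normal_density (s n * w) \<partial>lborel)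
      \<longlonglongrightarrow> sqrt (2 * pi) * (l2norm lborel k)\<^sup>2"
    by (simp only: tendsto_of_real_iff)
  then have "(\<lambda>n. ennreal (\<integral>w. (cmod (ft k w))\<^sup>2 * std_normal_density (s n * w) \<partial>lborel))
      \<longlonglongrightarrow> ennreal (sqrt (2 * pi) * (l2norm lborel k)\<^sup>2)"
    by (rule tendsto_ennrealI)
  moreover have "ennreal (\<integral>w. (cmod (ft k w))\<^sup>2 * std_normal_density (s n * w) \<partial>lborel)
      = (\<integral>\<^sup>+w. ?F n w \<partial>lborel)" for n
    by (rule nn_integral_eq_integral[symmetric, OF regularised_Plancherel(1)[OF k1 s_pos]]) auto
  ultimately have "(\<integral>\<^sup>+w. ennreal ((cmod (ft k w))\<^sup>2 * std_normal_density 0) \<partial>lborel)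
      = ennreal (sqrt (2 * pi) * (l2norm lborel k)\<^sup>2)"
    using LIMSEQ_unique[OF lhs] by simp
  \<comment> \<open>\<open>std_normal_density 0\<close> is the reciprocal of
    \<open>sqrt (2 * pi)\<close>; removing it supplies the second such factor.\<close>
  moreover have "(\<integral>\<^sup>+w. ennreal ((cmod (ft k w))\<^sup>2) \<partial>lborel)
     = ennreal (sqrt (2 * pi)) * (\<integral>\<^sup>+w. ennreal ((cmod (ft k w))\<^sup>2 * std_normal_density 0) \<partial>lborel)"
    by (subst nn_integral_cmult[symmetric])
       (auto intro!: nn_integral_cong simp: std_normal_density_def simp flip: ennreal_mult)
  ultimately show ?thesis
    by (simp add: nn_integral_eq_l2norm[OF k2] flip: ennreal_mult)
qed

section \<open>Linear canonical transforms\<close>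

lemma cmod_iexp_minus_1_le: "cmod (iexp x - 1) \<le> \<bar>x\<bar>"
  using iexp_approx1[of x 0] by simp

text \<open>The chirp in \<open>u\<close> has modulus one and disappears, the chirp in
  \<open>t\<close> is absorbed into the function, and the square root in the kernel has squared
  modulus \<open>2 * pi * \<bar>b\<bar>\<close>.\<close>

lemma cmod_lct_eq_ft:
  assumes b: "b \<noteq> 0"
  shows "(cmod (\<integral>t. h t * lct_kernel (a,b,c,d) t u \<partial>lborel))\<^sup>2
       = 1 / (2 * pi * \<bar>b\<bar>) * (cmod (ft (\<lambda>t. h t * iexp (a/(2*b) * t\<^sup>2)) (u / b)))\<^sup>2"
proof -
  let ?C = "1 / csqrt (\<i> * 2 * complex_of_real pi * complex_of_real b) * iexp (d/(2*b) * u\<^sup>2)"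
  have "h t * lct_kernel (a,b,c,d) t u = ?C * (h t * iexp (a/(2*b) * t\<^sup>2) * iexp (- (t * (u / b))))" for t
  proof -
    have "iexp (a/(2*b) * t\<^sup>2 - t*u/b + d/(2*b) * u\<^sup>2)
        = iexp (a/(2*b) * t\<^sup>2) * iexp (- (t * (u / b))) * iexp (d/(2*b) * u\<^sup>2)"
      unfolding iexp_add[symmetric] by (simp add: algebra_simps)
    then show ?thesis unfolding lct_kernel_def prod.case by (simp only: mult_ac)
  qed
  then have "(\<integral>t. h t * lct_kernel (a,b,c,d) t u \<partial>lborel)
      = ?C * ft (\<lambda>t. h t * iexp (a/(2*b) * t\<^sup>2)) (u / b)"
    unfolding ft_def by (simp only: integral_mult_right_zero)
  moreover have "(cmod ?C)\<^sup>2 = 1 / (2 * pi * \<bar>b\<bar>)"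
    by (simp add: norm_mult norm_divide power_divide)
  ultimately show ?thesis by (simp only: norm_mult power_mult_distrib)
qed

text \<open>Substituting \<open>u = b * w\<close> produces a Jacobian that cancels
  \<open>\<bar>b\<bar>\<close> in the kernel constant. The weight is 1 for Plancherel and
  \<open>(u - m)\<^sup>2\<close> for the second moment.\<close>

lemma nn_integral_lct_weighted:
  assumes b: "b \<noteq> 0" and [measurable]: "h \<in> borel_measurable borel" "W \<in> borel_measurable borel"
    and W: "\<And>u. 0 \<le> W u"
  shows "(\<integral>\<^sup>+u. ennreal (W u * (cmod (\<integral>t. h t * lct_kernel (a,b,c,d) t u \<partial>lborel))\<^sup>2) \<partial>lborel)
       = ennreal (1 / (2 * pi)) *
         (\<integral>\<^sup>+w. ennreal (W (b * w) * (cmod (ft (\<lambda>t. h t * iexp (a/(2*b) * t\<^sup>2)) w))\<^sup>2) \<partial>lborel)"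
proof -
  let ?k = "\<lambda>t. h t * iexp (a/(2*b) * t\<^sup>2)"
  have "(\<integral>\<^sup>+u. ennreal (W u * (cmod (\<integral>t. h t * lct_kernel (a,b,c,d) t u \<partial>lborel))\<^sup>2) \<partial>lborel)
      = (\<integral>\<^sup>+u. ennreal (W u * (1 / (2 * pi * \<bar>b\<bar>) * (cmod (ft ?k (u / b)))\<^sup>2)) \<partial>lborel)"
    by (simp only: cmod_lct_eq_ft[OF b])
  also have "\<dots> = \<bar>b\<bar> * (\<integral>\<^sup>+w. ennreal (W (0 + b * w) * (1 / (2 * pi * \<bar>b\<bar>) * (cmod (ft ?k ((0 + b * w) / b)))\<^sup>2)) \<partial>lborel)"
    using b by (intro nn_integral_real_affine) measurable
  also have "\<dots> = (\<integral>\<^sup>+w. \<bar>b\<bar> * ennreal (W (0 + b * w) * (1 / (2 * pi * \<bar>b\<bar>) * (cmod (ft ?k ((0 + b * w) / b)))\<^sup>2)) \<partial>lborel)"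
    by (rule nn_integral_cmult[symmetric]) measurable
  also have "\<dots> = (\<integral>\<^sup>+w. ennreal (1 / (2 * pi)) * ennreal (W (b * w) * (cmod (ft ?k w))\<^sup>2) \<partial>lborel)"
    using b W by (intro nn_integral_cong) (simp add: ennreal_mult[symmetric] field_simps)
  also have "\<dots> = ennreal (1 / (2 * pi)) * (\<integral>\<^sup>+w. ennreal (W (b * w) * (cmod (ft ?k w))\<^sup>2) \<partial>lborel)"
    by (rule nn_integral_cmult) measurable
  finally show ?thesis .
qed

lemma sqint_mult_iexp:
  assumes "sqint M k" and [measurable]: "h \<in> borel_measurable M"
  shows "sqint M (\<lambda>x. k x * iexp (h x))"
proof -
  have [measurable]: "k \<in> borel_measurable M" using assms(1) by (simp add: sqint_def)
  have "(\<lambda>x. k x * iexp (h x)) \<in> borel_measurable M" by measurable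
  then show ?thesis using assms(1) by (simp add: sqint_def norm_mult)
qed

lemma Plancherel_inverse:
  assumes "integrable lborel k" "sqint lborel k"
  shows "ennreal (1 / (2 * pi)) * (\<integral>\<^sup>+w. ennreal ((cmod (ft k w))\<^sup>2) \<partial>lborel)
       = (\<integral>\<^sup>+x. ennreal ((cmod (k x))\<^sup>2) \<partial>lborel)"
  by (simp add: Plancherel[OF assms] mult.assoc[symmetric] ennreal_mult[symmetric] del: ennreal_mult)

lemma lct_Plancherel:
  assumes b: "b \<noteq> 0" and h1: "integrable lborel h" and h2: "sqint lborel h"
  shows "(\<integral>\<^sup>+u. ennreal ((cmod (\<integral>t. h t * lct_kernel (a,b,c,d) t u \<partial>lborel))\<^sup>2) \<partial>lborel)
       = (\<integral>\<^sup>+t. ennreal ((cmod (h t))\<^sup>2) \<partial>lborel)"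
proof -
  have [measurable]: "h \<in> borel_measurable borel" using h2 by (simp add: sqint_def)
  have "integrable lborel (\<lambda>t. h t * iexp (a/(2*b) * t\<^sup>2))" "sqint lborel (\<lambda>t. h t * iexp (a/(2*b) * t\<^sup>2))"
    by (intro integrable_mult_iexp sqint_mult_iexp h1 h2; measurable)+
  from Plancherel_inverse[OF this] show ?thesis
    using nn_integral_lct_weighted[OF b, of h "\<lambda>_. 1" a c d] by (simp add: norm_mult)
qed

text \<open>Without its chirp, \<open>h\<close> is moved by a translation and a constant phase,
  which multiply the Fourier transform by \<open>iexp (s * (b * w - m))\<close>. Plancherel and
  \<open>cmod_iexp_minus_1_le\<close> then give the bound; extended integrals let it include an
  infinite second moment.\<close>

lemma displacement_bound_lct:
  assumes b: "b \<noteq> 0" and h1: "integrable lborel h" and h2: "sqint lborel h"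
  shows "(\<integral>\<^sup>+t. ennreal ((cmod (iexp (a * s*t + a*b * s\<^sup>2/2 - m * s) * h (t + s*b) - h t))\<^sup>2) \<partial>lborel)
       \<le> ennreal (s\<^sup>2) * (\<integral>\<^sup>+u. ennreal ((u - m)\<^sup>2 *
            (cmod (\<integral>t. h t * lct_kernel (a,b,c,d) t u \<partial>lborel))\<^sup>2) \<partial>lborel)"
proof -
  have [measurable]: "h \<in> borel_measurable borel" using h2 by (simp add: sqint_def)
  define k where "k = (\<lambda>t. h t * iexp (a/(2*b) * t\<^sup>2))"
  have k1: "integrable lborel k" and k2: "sqint lborel k"
    unfolding k_def by (intro integrable_mult_iexp sqint_mult_iexp h1 h2; measurable)+
  have [measurable]: "k \<in> borel_measurable borel" using k2 by (simp add: sqint_def)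
  define l where "l = (\<lambda>t. iexp (- (m * s)) * k (t + s*b) - k t)"
  have l1: "integrable lborel l"
    unfolding l_def by (intro Bochner_Integration.integrable_diff integrable_mult_right integrable_shift k1)
  have l2: "sqint lborel l"
    unfolding l_def
    using sqint_mult_iexp[OF sqint_shift(1)[OF k2, of "s*b"], of "\<lambda>_. - (m * s)"]
    by (intro sqint_diff k2) (simp add: mult.commute)
  have ftl: "ft l w = (iexp (s * (b * w - m)) - 1) * ft k w" for w
  proof -
    have e: "l t * iexp (- (t * w)) = iexp (s * (b * w - m)) * (k (t + s*b) * iexp (- ((t + s*b) * w)))
        - k t * iexp (- (t * w))" for t
    proof -
      have "iexp (- (m * s)) * iexp (- (t * w)) = iexp (s * (b * w - m)) * iexp (- ((t + s*b) * w))"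
        unfolding iexp_add[symmetric] by (simp add: algebra_simps)
      then show ?thesis unfolding l_def left_diff_distrib by (simp only: mult_ac)
    qed
    have i: "integrable lborel (\<lambda>t. k t * iexp (- (t * w)))"
      by (intro integrable_mult_iexp[of lborel k "\<lambda>t. - (t * w)"] k1) measurable
    have "ft l w = iexp (s * (b * w - m)) * (\<integral>t. k (t + s*b) * iexp (- ((t + s*b) * w)) \<partial>lborel) - ft k w"
      unfolding ft_def e
      using i integrable_shift[OF i, of "s*b"]
      by (subst Bochner_Integration.integral_diff) (auto simp only: integral_mult_right_zero integrable_mult_right)
    also have "(\<integral>t. k (t + s*b) * iexp (- ((t + s*b) * w)) \<partial>lborel) = ft k w"
      unfolding ft_def by (rule integral_shift) measurable
    finally show ?thesis by (simp add: left_diff_distrib)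
  qed
  have "cmod (iexp (a * s*t + a*b * s\<^sup>2/2 - m * s) * h (t + s*b) - h t) = cmod (l t)" for t
  proof -
    \<comment> \<open>Expanding the square in the translated chirp yields exactly the linear and
      quadratic phases of the displacement.\<close>
    have "iexp (- (m * s)) * iexp (a/(2*b) * (t + s*b)\<^sup>2)
        = iexp (a/(2*b) * t\<^sup>2) * iexp (a * s*t + a*b * s\<^sup>2/2 - m * s)"
      unfolding iexp_add[symmetric] using b by (intro arg_cong[where f=iexp]) (simp add: power2_eq_square field_simps)
    then have "l t = iexp (a/(2*b) * t\<^sup>2) * (iexp (a * s*t + a*b * s\<^sup>2/2 - m * s) * h (t + s*b) - h t)"
      unfolding l_def k_def right_diff_distrib by (simp add: mult_ac)
    then show ?thesis by (simp only: norm_mult norm_exp_i_times mult_1)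
  qed
  then have "(\<integral>\<^sup>+t. ennreal ((cmod (iexp (a * s*t + a*b * s\<^sup>2/2 - m * s) * h (t + s*b) - h t))\<^sup>2) \<partial>lborel)
      = (\<integral>\<^sup>+t. ennreal ((cmod (l t))\<^sup>2) \<partial>lborel)" by simp
  also have "\<dots> = ennreal (1 / (2 * pi)) * (\<integral>\<^sup>+w. ennreal ((cmod (ft l w))\<^sup>2) \<partial>lborel)"
    by (rule Plancherel_inverse[OF l1 l2, symmetric])
  also have "\<dots> \<le> ennreal (1 / (2 * pi)) *
      (\<integral>\<^sup>+w. ennreal (s\<^sup>2) * ennreal ((b * w - m)\<^sup>2 * (cmod (ft k w))\<^sup>2) \<partial>lborel)"
  proof (intro mult_left_mono nn_integral_mono)
    fix w
    have "(cmod (ft l w))\<^sup>2 \<le> (\<bar>s * (b * w - m)\<bar> * cmod (ft k w))\<^sup>2"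
      unfolding ftl norm_mult
      by (intro power_mono mult_right_mono cmod_iexp_minus_1_le) auto
    also have "\<dots> = s\<^sup>2 * ((b * w - m)\<^sup>2 * (cmod (ft k w))\<^sup>2)"
      by (simp add: power_mult_distrib)
    finally show "ennreal ((cmod (ft l w))\<^sup>2) \<le> ennreal (s\<^sup>2) * ennreal ((b * w - m)\<^sup>2 * (cmod (ft k w))\<^sup>2)"
      by (simp add: ennreal_leI flip: ennreal_mult)
  qed auto
  also have "\<dots> = ennreal (s\<^sup>2) * (ennreal (1 / (2 * pi)) *
      (\<integral>\<^sup>+w. ennreal ((b * w - m)\<^sup>2 * (cmod (ft k w))\<^sup>2) \<partial>lborel))"
    by (subst nn_integral_cmult) (measurable, simp only: mult_ac)
  also have "ennreal (1 / (2 * pi)) * (\<integral>\<^sup>+w. ennreal ((b * w - m)\<^sup>2 * (cmod (ft k w))\<^sup>2) \<partial>lborel)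
      = (\<integral>\<^sup>+u. ennreal ((u - m)\<^sup>2 * (cmod (\<integral>t. h t * lct_kernel (a,b,c,d) t u \<partial>lborel))\<^sup>2) \<partial>lborel)"
    unfolding k_def by (rule nn_integral_lct_weighted[OF b, symmetric]) auto
  finally show ?thesis .
qed

section \<open>Uncertainty from the Weyl relation\<close>

text \<open>
  On the second variable \<open>\<tau>\<close>, \<open>displace a b m s\<close> is \<open>exp (i s (P - m))\<close> for the self-adjoint operator
  \<open>P = a \<tau> - i b d/d\<tau>\<close>, which the LCT with parameter \<open>(a,b,c,d)\<close> turns into multiplication by \<open>u\<close>.
\<close>

definition displace :: "real \<Rightarrow> real \<Rightarrow> real \<Rightarrow> real \<Rightarrow> (real \<times> real \<Rightarrow> complex) \<Rightarrow> real \<times> real \<Rightarrow> complex" where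
  "displace a b m s h p = iexp (a * s * snd p + a*b * s\<^sup>2/2 - m * s) * h (p + (0, s*b))"

definition ip :: "(real \<times> real \<Rightarrow> complex) \<Rightarrow> (real \<times> real \<Rightarrow> complex) \<Rightarrow> complex" where
  "ip x y = (\<integral>p. x p * cnj (y p) \<partial>lborel)"

lemma borel_measurable_fst_real [measurable]: "(fst :: real \<times> real \<Rightarrow> real) \<in> borel_measurable borel"
  by (intro borel_measurable_continuous_onI continuous_intros)

lemma borel_measurable_snd_real [measurable]: "(snd :: real \<times> real \<Rightarrow> real) \<in> borel_measurable borel"
  by (intro borel_measurable_continuous_onI continuous_intros)

lemma borel_measurable_displace [measurable]:
  assumes [measurable]: "h \<in> borel_measurable borel"
  shows "displace a b m s h \<in> borel_measurable borel"
  unfolding displace_def[abs_def] by measurable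

lemma displace_sqint:
  assumes "sqint lborel h"
  shows "sqint lborel (displace a b m s h)" "l2norm lborel (displace a b m s h) = l2norm lborel h"
proof -
  have "sqint lborel (\<lambda>p. h (p + (0, s*b)) * iexp (a * s * snd p + a*b * s\<^sup>2/2 - m * s))"
    by (intro sqint_mult_iexp sqint_shift assms) measurable
  then show "sqint lborel (displace a b m s h)"
    by (simp only: displace_def[abs_def] mult.commute)
  show "l2norm lborel (displace a b m s h) = l2norm lborel h"
    using sqint_shift(2)[OF assms, of "(0, s*b)"] by (simp add: l2norm_def displace_def norm_mult)
qed

text \<open>Translating the integration variable moves the displacement to the other side. The phase
  \<open>a*b * s\<^sup>2/2\<close> is what makes parameter \<open>- s\<close> give the
  adjoint.\<close>

lemma ip_displace_adjoint:
  assumes "sqint lborel h"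
  shows "ip (displace a b m s h) h = ip h (displace a b m (- s) h)"
proof -
  have [measurable]: "h \<in> borel_measurable borel" using assms by (simp add: sqint_def)
  let ?w = "\<lambda>p. h p * cnj (displace a b m (- s) h p)"
  have "ip h (displace a b m (- s) h) = (\<integral>p. ?w (p + (0, s*b)) \<partial>lborel)"
    unfolding ip_def by (rule integral_shift[symmetric]) measurable
  also have "\<dots> = ip (displace a b m s h) h"
    unfolding ip_def
  proof (rule Bochner_Integration.integral_cong[OF refl])
    fix p :: "real \<times> real"
    have "cnj (displace a b m (- s) h (p + (0, s*b))) = iexp (a * s * snd p + a*b * s\<^sup>2/2 - m * s) * cnj (h p)"
      unfolding displace_def complex_cnj_mult cnj_iexp
      by (intro arg_cong2[where f="(*)"] arg_cong[where f=iexp] arg_cong[where f=cnj] arg_cong[where f=h])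
         (auto simp: algebra_simps power2_eq_square prod_eq_iff)
    then show "?w (p + (0, s*b)) = displace a b m s h p * cnj (h p)"
      by (simp only: displace_def mult_ac)
  qed
  finally show ?thesis by simp
qed

text \<open>The Weyl commutation relation in weak form: with the adjoints moved to the right, no
  composition of displacements has to be written.\<close>

lemma ip_displace_Weyl:
  assumes "sqint lborel h"
  shows "ip (displace a2 b2 n s h) (displace a1 b1 m (- s) h)
       = iexp (- (s\<^sup>2 * (a1*b2 - a2*b1))) * ip (displace a1 b1 m s h) (displace a2 b2 n (- s) h)"
proof -
  have [measurable]: "h \<in> borel_measurable borel" using assms by (simp add: sqint_def)
  let ?w = "\<lambda>p. displace a2 b2 n s h p * cnj (displace a1 b1 m (- s) h p)"
  \<comment> \<open>After this shift both products evaluate \<open>h\<close> at the same two points,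
    so only a phase independent of \<open>p\<close> distinguishes them.\<close>
  let ?c = "(0, s*b1 - s*b2) :: real \<times> real"
  have "ip (displace a2 b2 n s h) (displace a1 b1 m (- s) h) = (\<integral>p. ?w (p + ?c) \<partial>lborel)"
    unfolding ip_def by (rule integral_shift[symmetric]) measurable
  also have "\<dots> = (\<integral>p. iexp (- (s\<^sup>2 * (a1*b2 - a2*b1))) *
      (displace a1 b1 m s h p * cnj (displace a2 b2 n (- s) h p)) \<partial>lborel)"
  proof (rule Bochner_Integration.integral_cong[OF refl])
    fix p :: "real \<times> real"
    define e1 where "e1 = a2 * s * snd (p + ?c) + a2*b2 * s\<^sup>2/2 - n * s"
    define e2 where "e2 = a1*(-s) * snd (p + ?c) + a1*b1*(-s)\<^sup>2/2 - m*(-s)"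
    define e3 where "e3 = a1 * s * snd p + a1*b1 * s\<^sup>2/2 - m * s"
    define e4 where "e4 = a2*(-s) * snd p + a2*b2*(-s)\<^sup>2/2 - n*(-s)"
    have pts: "p + ?c + (0, s*b2) = p + (0, s*b1)" "p + ?c + (0, - s*b1) = p + (0, - s*b2)"
      by (auto simp: prod_eq_iff)
    have "iexp e1 * iexp (- e2) = iexp (- (s\<^sup>2 * (a1*b2 - a2*b1))) * (iexp e3 * iexp (- e4))"
      unfolding iexp_add[symmetric] e1_def e2_def e3_def e4_def
      by (intro arg_cong[where f=iexp]) (simp add: algebra_simps power2_eq_square)
    moreover have "?w (p + ?c) = iexp e1 * iexp (- e2) * (h (p + (0, s*b1)) * cnj (h (p + (0, - s*b2))))"
      unfolding displace_def complex_cnj_mult cnj_iexp pts e1_def e2_def by (simp only: mult_ac)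
    moreover have "displace a1 b1 m s h p * cnj (displace a2 b2 n (- s) h p)
        = iexp e3 * iexp (- e4) * (h (p + (0, s*b1)) * cnj (h (p + (0, - s*b2))))"
      unfolding displace_def complex_cnj_mult cnj_iexp e3_def e4_def by (simp only: mult_ac)
    ultimately show "?w (p + ?c) = iexp (- (s\<^sup>2 * (a1*b2 - a2*b1))) *
        (displace a1 b1 m s h p * cnj (displace a2 b2 n (- s) h p))"
      by (simp only: mult.assoc)
  qed
  also have "\<dots> = iexp (- (s\<^sup>2 * (a1*b2 - a2*b1))) * ip (displace a1 b1 m s h) (displace a2 b2 n (- s) h)"
    unfolding ip_def by (rule integral_mult_right_zero)
  finally show ?thesis .
qed

lemma ip_diff:
  assumes "sqint lborel x" "sqint lborel y" "sqint lborel z"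
  shows "ip (\<lambda>p. x p - y p) z = ip x z - ip y z" "ip z (\<lambda>p. x p - y p) = ip z x - ip z y"
  using assms
  by (simp_all add: ip_def left_diff_distrib right_diff_distrib sqint_mult_integrable Bochner_Integration.integral_diff)

text \<open>The quadratic error gives the exact limit \<open>\<bar>D\<bar>\<close> of the commutator
  phase divided by \<open>s\<^sup>2\<close>, hence the sharp constant.\<close>

lemma cmod_iexp_minus_1_approx: "\<bar>cmod (iexp x - 1) - \<bar>x\<bar>\<bar> \<le> x\<^sup>2 / 2"
proof -
  have "cmod ((iexp x - 1) - \<i> * x) \<le> x\<^sup>2 / 2"
    using iexp_approx1[of x 1] by (simp add: diff_diff_eq power2_eq_square abs_mult_self_eq)
  moreover have "cmod (\<i> * complex_of_real x) = \<bar>x\<bar>" by (simp add: norm_mult)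
  ultimately show ?thesis
    using norm_triangle_ineq3[of "iexp x - 1" "\<i> * complex_of_real x"] by linarith
qed

text \<open>\<open>X\<close> and \<open>Y\<close> abstract the displacement rates; in the
  application they are the square roots of the two centred second moments.\<close>

lemma Weyl_uncertainty:
  assumes h: "sqint lborel h"
    and A: "\<And>s. l2norm lborel (\<lambda>p. displace a1 b1 m s h p - h p) \<le> \<bar>s\<bar> * X"
    and B: "\<And>s. l2norm lborel (\<lambda>p. displace a2 b2 n s h p - h p) \<le> \<bar>s\<bar> * Y"
  shows "\<bar>a1*b2 - a2*b1\<bar> * (l2norm lborel h)\<^sup>2 \<le> 2 * X * Y"
proof -
  define D where "D = a1*b2 - a2*b1"
  define N where "N = l2norm lborel h"
  let ?U = "\<lambda>s. displace a1 b1 m s h" and ?V = "\<lambda>s. displace a2 b2 n s h"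
  define P where "P s = ip (?U s) (?V (- s))" for s
  have X0: "0 \<le> X" using order_trans[OF l2norm_nonneg A[of 1]] by simp
  have Y0: "0 \<le> Y" using order_trans[OF l2norm_nonneg B[of 1]] by simp
  have U: "sqint lborel (?U s)" and V: "sqint lborel (?V s)"
    and U': "sqint lborel (\<lambda>p. ?U s p - h p)" and V': "sqint lborel (\<lambda>p. ?V s p - h p)" for s
    by (intro displace_sqint sqint_diff h)+
  have N0: "0 \<le> N" by (simp add: N_def l2norm_nonneg)
  have hh: "ip h h = complex_of_real (N\<^sup>2)"
    by (simp only: ip_def N_def l2norm_sq complex_norm_square[symmetric] integral_complex_of_real)
  have est1: "cmod (iexp (- (s\<^sup>2 * D)) - 1) * cmod (P s) \<le> s\<^sup>2 * (2 * X * Y)" if "0 < s" for s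
  proof -
    \<comment> \<open>Expanding the right side, the copies of \<open>ip h h\<close> cancel and the
      mixed terms cancel by the adjoint relation; the two remaining terms differ by the Weyl
      phase.\<close>
    have "(iexp (- (s\<^sup>2 * D)) - 1) * P s
      = ip (\<lambda>p. ?V s p - h p) (\<lambda>p. ?U (- s) p - h p) - ip (\<lambda>p. ?U s p - h p) (\<lambda>p. ?V (- s) p - h p)"
      using ip_displace_Weyl[OF h, of a2 b2 n s a1 b1 m] ip_displace_adjoint[OF h, of a1 b1 m s]
        ip_displace_adjoint[OF h, of a2 b2 n s]
      by (simp add: ip_diff U V U' V' h P_def D_def left_diff_distrib)
    moreover have "cmod (ip (\<lambda>p. ?V s p - h p) (\<lambda>p. ?U (- s) p - h p)) \<le> (s * Y) * (s * X)"
      unfolding ip_def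
      using order_trans[OF Cauchy_Schwarz_sqint[OF V'[of s] U'[of "- s"]]
          mult_mono[OF B[of s] A[of "- s"] _ l2norm_nonneg]] that X0 Y0 by simp
    moreover have "cmod (ip (\<lambda>p. ?U s p - h p) (\<lambda>p. ?V (- s) p - h p)) \<le> (s * X) * (s * Y)"
      unfolding ip_def
      using order_trans[OF Cauchy_Schwarz_sqint[OF U'[of s] V'[of "- s"]]
          mult_mono[OF A[of s] B[of "- s"] _ l2norm_nonneg]] that X0 Y0 by simp
    ultimately have "cmod ((iexp (- (s\<^sup>2 * D)) - 1) * P s) \<le> (s * Y) * (s * X) + (s * X) * (s * Y)"
      by (simp only:) (rule order_trans[OF norm_triangle_ineq4 add_mono])
    also have "\<dots> = s\<^sup>2 * (2 * X * Y)" by (simp add: power2_eq_square)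
    finally show ?thesis by (simp only: norm_mult)
  qed
  \<comment> \<open>Both displacements tend to the identity on \<open>h\<close>, so
    \<open>P s\<close> tends to \<open>ip h h\<close>; the error is at most linear in
    \<open>s\<close>.\<close>
  have est2: "\<bar>cmod (P s) - N\<^sup>2\<bar> \<le> s * (X * N + N * Y)" if "0 < s" for s
  proof -
    have "P s - ip h h = ip (\<lambda>p. ?U s p - h p) (?V (- s)) + ip h (\<lambda>p. ?V (- s) p - h p)"
      by (simp add: ip_diff U V U' V' h P_def)
    moreover have "cmod (ip (\<lambda>p. ?U s p - h p) (?V (- s))) \<le> s * X * N"
      using Cauchy_Schwarz_sqint[OF U'[of s] V[of "- s"]] mult_right_mono[OF A[of s] N0] that
      unfolding ip_def displace_sqint(2)[OF h] N_def by simp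
    moreover have "cmod (ip h (\<lambda>p. ?V (- s) p - h p)) \<le> N * (s * Y)"
      using Cauchy_Schwarz_sqint[OF h V'[of "- s"]] mult_left_mono[OF B[of "- s"] N0] that
      unfolding ip_def N_def by simp
    ultimately have "cmod (P s - ip h h) \<le> s * X * N + N * (s * Y)"
      by (simp only:) (rule order_trans[OF norm_triangle_ineq add_mono])
    moreover have "cmod (ip h h) = N\<^sup>2" unfolding hh by (simp only: norm_of_real abs_power2)
    ultimately show ?thesis
      using norm_triangle_ineq3[of "P s" "ip h h"] by (simp add: algebra_simps)
  qed
  have lim2: "((\<lambda>s. cmod (P s)) \<longlongrightarrow> N\<^sup>2) (at_right 0)"
  proof (rule LIM_zero_cancel, rule Lim_null_comparison)
    show "eventually (\<lambda>s. norm (cmod (P s) - N\<^sup>2) \<le> s * (X * N + N * Y)) (at_right 0)"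
      unfolding eventually_at_filter using est2 by (auto intro!: always_eventually)
    show "((\<lambda>s. s * (X * N + N * Y)) \<longlongrightarrow> 0) (at_right 0)"
      by (intro tendsto_mult_left_zero tendsto_ident_at)
  qed
  have lim1: "((\<lambda>s. cmod (iexp (- (s\<^sup>2 * D)) - 1) / s\<^sup>2) \<longlongrightarrow> \<bar>D\<bar>) (at_right 0)"
  proof (rule LIM_zero_cancel, rule Lim_null_comparison)
    have "\<bar>cmod (iexp (- (s\<^sup>2 * D)) - 1) / s\<^sup>2 - \<bar>D\<bar>\<bar> \<le> s\<^sup>2 * (D\<^sup>2 / 2)" if "0 < s" for s
    proof -
      have "\<bar>cmod (iexp (- (s\<^sup>2 * D)) - 1) - s\<^sup>2 * \<bar>D\<bar>\<bar> \<le> s\<^sup>2 * (s\<^sup>2 * (D\<^sup>2 / 2))"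
        using cmod_iexp_minus_1_approx[of "- (s\<^sup>2 * D)"]
        by (simp add: abs_mult power_mult_distrib power2_eq_square mult_ac)
      moreover have "cmod (iexp (- (s\<^sup>2 * D)) - 1) / s\<^sup>2 - \<bar>D\<bar>
          = (cmod (iexp (- (s\<^sup>2 * D)) - 1) - s\<^sup>2 * \<bar>D\<bar>) / s\<^sup>2"
        using that by (simp add: diff_divide_distrib)
      ultimately show ?thesis
        using that by (simp only: abs_divide abs_power2) (simp add: divide_le_eq mult_ac)
    qed
    then show "eventually (\<lambda>s. norm (cmod (iexp (- (s\<^sup>2 * D)) - 1) / s\<^sup>2 - \<bar>D\<bar>) \<le> s\<^sup>2 * (D\<^sup>2 / 2)) (at_right 0)"
      unfolding eventually_at_filter by (auto intro!: always_eventually)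
    have "((\<lambda>s::real. s\<^sup>2 * (D\<^sup>2 / 2)) \<longlongrightarrow> 0\<^sup>2 * (D\<^sup>2 / 2)) (at_right 0)"
      by (intro tendsto_intros)
    then show "((\<lambda>s::real. s\<^sup>2 * (D\<^sup>2 / 2)) \<longlongrightarrow> 0) (at_right 0)" by simp
  qed
  \<comment> \<open>Divide \<open>est1\<close> by \<open>s\<^sup>2\<close> and let \<open>s\<close>
    decrease to 0.\<close>
  have "\<bar>D\<bar> * N\<^sup>2 \<le> 2 * X * Y"
  proof (rule tendsto_upperbound[OF tendsto_mult[OF lim1 lim2]])
    have "cmod (iexp (- (s\<^sup>2 * D)) - 1) / s\<^sup>2 * cmod (P s) \<le> 2 * X * Y" if "0 < s" for s
      using est1[OF that] that by (simp add: divide_le_eq mult_ac)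
    then show "eventually (\<lambda>s. cmod (iexp (- (s\<^sup>2 * D)) - 1) / s\<^sup>2 * cmod (P s) \<le> 2 * X * Y) (at_right 0)"
      unfolding eventually_at_filter by (auto intro!: always_eventually)
  qed simp
  then show ?thesis by (simp add: D_def N_def)
qed

section \<open>The short-time transform\<close>

text \<open>The function \<open>H\<close> of the overview. The first coordinate is the window
  position; the second is the integration variable, on which \<open>displace\<close> acts.\<close>

definition windowed :: "(real \<Rightarrow> complex) \<Rightarrow> (real \<Rightarrow> complex) \<Rightarrow> real \<times> real \<Rightarrow> complex" where
  "windowed g f p = f (snd p) * cnj (g (snd p - fst p))"

lemma stlct_windowed: "stlct M g f t u = (\<integral>\<tau>. windowed g f (t, \<tau>) * lct_kernel M \<tau> u \<partial>lborel)"
  by (simp add: stlct_def windowed_def)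

lemma borel_measurable_windowed [measurable]:
  assumes [measurable]: "f \<in> borel_measurable borel" "g \<in> borel_measurable borel"
  shows "windowed g f \<in> borel_measurable borel"
  unfolding windowed_def[abs_def] by measurable

lemma borel_measurable_stlct [measurable]:
  assumes [measurable]: "f \<in> borel_measurable borel" "g \<in> borel_measurable borel"
  shows "(\<lambda>p. stlct M g f (fst p) (snd p)) \<in> borel_measurable (lborel \<Otimes>\<^sub>M lborel)"
proof -
  obtain a b c d where M: "M = (a,b,c,d)" by (cases M)
  show ?thesis
    unfolding stlct_def M lct_kernel_def prod.case by measurable
qed

text \<open>Integrating first over the window position decouples the factors, since reflection and
  translation preserve the norm of \<open>g\<close>.\<close>

lemma nn_integral_windowed:
  assumes [measurable]: "f \<in> borel_measurable borel" "g \<in> borel_measurable borel"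
  shows "(\<integral>\<^sup>+p. ennreal ((cmod (windowed g f p))\<^sup>2) \<partial>lborel)
    = (\<integral>\<^sup>+x. ennreal ((cmod (f x))\<^sup>2) \<partial>lborel) * (\<integral>\<^sup>+x. ennreal ((cmod (g x))\<^sup>2) \<partial>lborel)"
proof -
  have inner: "(\<integral>\<^sup>+t. ennreal ((cmod (g (\<tau> - t)))\<^sup>2) \<partial>lborel) = (\<integral>\<^sup>+x. ennreal ((cmod (g x))\<^sup>2) \<partial>lborel)" for \<tau>
    using nn_integral_real_affine[of "\<lambda>x. ennreal ((cmod (g x))\<^sup>2)" "-1" \<tau>] by simp
  have "(\<integral>\<^sup>+p. ennreal ((cmod (windowed g f p))\<^sup>2) \<partial>lborel)
      = (\<integral>\<^sup>+p. ennreal ((cmod (windowed g f p))\<^sup>2) \<partial>(lborel \<Otimes>\<^sub>M lborel))"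
    by (simp only: lborel_prod)
  also have "\<dots> = (\<integral>\<^sup>+\<tau>. (\<integral>\<^sup>+t. ennreal ((cmod (windowed g f (t, \<tau>)))\<^sup>2) \<partial>lborel) \<partial>lborel)"
    by (rule lborel_pair.nn_integral_snd[symmetric]) (simp add: lborel_prod)
  also have "\<dots> = (\<integral>\<^sup>+\<tau>. ennreal ((cmod (f \<tau>))\<^sup>2) * (\<integral>\<^sup>+t. ennreal ((cmod (g (\<tau> - t)))\<^sup>2) \<partial>lborel) \<partial>lborel)"
    by (simp add: windowed_def norm_mult power_mult_distrib ennreal_mult nn_integral_cmult)
  also have "\<dots> = (\<integral>\<^sup>+x. ennreal ((cmod (f x))\<^sup>2) \<partial>lborel) * (\<integral>\<^sup>+x. ennreal ((cmod (g x))\<^sup>2) \<partial>lborel)"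
    by (simp add: inner nn_integral_multc)
  finally show ?thesis .
qed

lemma integrable_windowed_slice:
  assumes "sqint lborel f" "sqint lborel g"
  shows "integrable lborel (\<lambda>\<tau>. windowed g f (t, \<tau>))"
  using sqint_mult_integrable[OF assms(1) sqint_shift(1)[OF assms(2), of "- t"]]
  by (simp add: windowed_def)

lemma sqint_windowed:
  assumes "sqint lborel f" "sqint lborel g"
  shows "sqint lborel (windowed g f)"
proof -
  have [measurable]: "f \<in> borel_measurable borel" "g \<in> borel_measurable borel"
    using assms by (auto simp: sqint_def)
  show ?thesis
    using assms nn_integral_windowed[of f g]
    by (subst sqint_iff_nn_integral) (auto simp: nn_integral_eq_l2norm ennreal_mult_less_top)
qed

text \<open>A finite iterated integral has finite inner integrals almost everywhere. This is what
  allows Plancherel on slices.\<close>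

lemma AE_sqint_windowed_slice:
  assumes "sqint lborel f" "sqint lborel g"
  shows "AE t in lborel. sqint lborel (\<lambda>\<tau>. windowed g f (t, \<tau>))"
proof -
  have [measurable]: "f \<in> borel_measurable borel" "g \<in> borel_measurable borel"
    using assms by (auto simp: sqint_def)
  have [measurable]: "windowed g f \<in> borel_measurable (lborel \<Otimes>\<^sub>M lborel)"
    by (simp add: lborel_prod)
  have "(\<integral>\<^sup>+t. (\<integral>\<^sup>+\<tau>. ennreal ((cmod (windowed g f (t, \<tau>)))\<^sup>2) \<partial>lborel) \<partial>lborel)
      = (\<integral>\<^sup>+p. ennreal ((cmod (windowed g f p))\<^sup>2) \<partial>lborel)"
    by (subst lborel.nn_integral_fst) (auto simp: lborel_prod)
  also have "\<dots> \<noteq> \<infinity>"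
    using nn_integral_eq_l2norm[OF sqint_windowed[OF assms]] by simp
  finally have "AE t in lborel. (\<integral>\<^sup>+\<tau>. ennreal ((cmod (windowed g f (t, \<tau>)))\<^sup>2) \<partial>lborel) \<noteq> \<infinity>"
    by (intro nn_integral_PInf_AE) measurable
  then show ?thesis
    by eventually_elim (subst sqint_iff_nn_integral, auto simp: less_top)
qed

lemma nn_integral_stlct:
  assumes b: "b \<noteq> 0" and fg: "sqint lborel f" "sqint lborel g"
  shows "(\<integral>\<^sup>+p. ennreal ((cmod (stlct (a,b,c,d) g f (fst p) (snd p)))\<^sup>2) \<partial>(lborel \<Otimes>\<^sub>M lborel))
       = (\<integral>\<^sup>+p. ennreal ((cmod (windowed g f p))\<^sup>2) \<partial>lborel)"
proof -
  have [measurable]: "f \<in> borel_measurable borel" "g \<in> borel_measurable borel"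
    using fg by (auto simp: sqint_def)
  have [measurable]: "windowed g f \<in> borel_measurable (lborel \<Otimes>\<^sub>M lborel)"
    by (simp add: lborel_prod)
  let ?S = "stlct (a,b,c,d) g f"
  have "(\<integral>\<^sup>+p. ennreal ((cmod (?S (fst p) (snd p)))\<^sup>2) \<partial>(lborel \<Otimes>\<^sub>M lborel))
      = (\<integral>\<^sup>+t. (\<integral>\<^sup>+u. ennreal ((cmod (?S t u))\<^sup>2) \<partial>lborel) \<partial>lborel)"
    by (subst lborel.nn_integral_fst[symmetric]) auto
  also have "\<dots> = (\<integral>\<^sup>+t. (\<integral>\<^sup>+\<tau>. ennreal ((cmod (windowed g f (t, \<tau>)))\<^sup>2) \<partial>lborel) \<partial>lborel)"
  proof (rule nn_integral_cong_AE)
    show "AE t in lborel. (\<integral>\<^sup>+u. ennreal ((cmod (?S t u))\<^sup>2) \<partial>lborel)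
        = (\<integral>\<^sup>+\<tau>. ennreal ((cmod (windowed g f (t, \<tau>)))\<^sup>2) \<partial>lborel)"
      using AE_sqint_windowed_slice[OF fg]
    proof eventually_elim
      case (elim t)
      show ?case
        unfolding stlct_windowed by (rule lct_Plancherel[OF b integrable_windowed_slice[OF fg] elim])
    qed
  qed
  also have "\<dots> = (\<integral>\<^sup>+p. ennreal ((cmod (windowed g f p))\<^sup>2) \<partial>lborel)"
    by (subst lborel.nn_integral_fst) (auto simp: lborel_prod)
  finally show ?thesis .
qed

text \<open>\<open>displace\<close> leaves the window position fixed, so the one-dimensional bound
  applies to almost every slice and is integrated over \<open>t\<close>.\<close>

lemma displacement_bound_stlct:
  assumes b: "b \<noteq> 0" and fg: "sqint lborel f" "sqint lborel g"
  shows "(\<integral>\<^sup>+p. ennreal ((cmod (displace a b m s (windowed g f) p - windowed g f p))\<^sup>2) \<partial>lborel)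
       \<le> ennreal (s\<^sup>2) * (\<integral>\<^sup>+p. ennreal ((snd p - m)\<^sup>2 *
            (cmod (stlct (a,b,c,d) g f (fst p) (snd p)))\<^sup>2) \<partial>(lborel \<Otimes>\<^sub>M lborel))"
proof -
  have [measurable]: "f \<in> borel_measurable borel" "g \<in> borel_measurable borel"
    using fg by (auto simp: sqint_def)
  let ?S = "stlct (a,b,c,d) g f" and ?H = "windowed g f"
  let ?W = "\<lambda>p. ennreal ((cmod (displace a b m s ?H p - ?H p))\<^sup>2)"
  have [measurable]: "?W \<in> borel_measurable (lborel \<Otimes>\<^sub>M lborel)"
    by (simp add: lborel_prod)
  have "(\<integral>\<^sup>+p. ?W p \<partial>lborel) = (\<integral>\<^sup>+t. (\<integral>\<^sup>+\<tau>. ?W (t, \<tau>) \<partial>lborel) \<partial>lborel)"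
    by (subst lborel.nn_integral_fst) (auto simp: lborel_prod)
  also have "\<dots> \<le> (\<integral>\<^sup>+t. ennreal (s\<^sup>2) * (\<integral>\<^sup>+u. ennreal ((u - m)\<^sup>2 * (cmod (?S t u))\<^sup>2) \<partial>lborel) \<partial>lborel)"
  proof (rule nn_integral_mono_AE)
    show "AE t in lborel. (\<integral>\<^sup>+\<tau>. ?W (t, \<tau>) \<partial>lborel)
        \<le> ennreal (s\<^sup>2) * (\<integral>\<^sup>+u. ennreal ((u - m)\<^sup>2 * (cmod (?S t u))\<^sup>2) \<partial>lborel)"
      using AE_sqint_windowed_slice[OF fg]
    proof eventually_elim
      case (elim t)
      show ?case
        using displacement_bound_lct[OF b integrable_windowed_slice[OF fg, of t] elim, of a s m c d]
        by (simp only: stlct_windowed displace_def snd_conv add_Pair add_0_right)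
    qed
  qed
  also have "\<dots> = ennreal (s\<^sup>2) * (\<integral>\<^sup>+t. (\<integral>\<^sup>+u. ennreal ((snd (t, u) - m)\<^sup>2 * (cmod (?S (fst (t, u)) (snd (t, u))))\<^sup>2) \<partial>lborel) \<partial>lborel)"
    by (subst nn_integral_cmult) (auto intro!: lborel.borel_measurable_nn_integral_fst)
  also have "(\<integral>\<^sup>+t. (\<integral>\<^sup>+u. ennreal ((snd (t, u) - m)\<^sup>2 * (cmod (?S (fst (t, u)) (snd (t, u))))\<^sup>2) \<partial>lborel) \<partial>lborel)
      = (\<integral>\<^sup>+p. ennreal ((snd p - m)\<^sup>2 * (cmod (?S (fst p) (snd p)))\<^sup>2) \<partial>(lborel \<Otimes>\<^sub>M lborel))"
    by (rule lborel.nn_integral_fst) measurable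
  finally show ?thesis .
qed

text \<open>The weight vanishes only on the null line \<open>snd p = m\<close>, so a zero moment
  would force the transform, and hence its norm, to vanish. This excludes a product of 0 and
  infinity in the final inequality.\<close>

lemma stlct_second_moment_pos:
  assumes b: "b \<noteq> 0" and fg: "sqint lborel f" "sqint lborel g"
    and N: "0 < l2norm lborel (windowed g f)"
  shows "(\<integral>\<^sup>+p. ennreal ((snd p - m)\<^sup>2 *
            (cmod (stlct (a,b,c,d) g f (fst p) (snd p)))\<^sup>2) \<partial>(lborel \<Otimes>\<^sub>M lborel)) \<noteq> 0"
proof
  let ?S = "stlct (a,b,c,d) g f"
  have [measurable]: "f \<in> borel_measurable borel" "g \<in> borel_measurable borel"
    using fg by (auto simp: sqint_def)
  assume "(\<integral>\<^sup>+p. ennreal ((snd p - m)\<^sup>2 * (cmod (?S (fst p) (snd p)))\<^sup>2) \<partial>(lborel \<Otimes>\<^sub>M lborel)) = 0"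
  then have "AE p in lborel \<Otimes>\<^sub>M lborel. ennreal ((snd p - m)\<^sup>2 * (cmod (?S (fst p) (snd p)))\<^sup>2) = 0"
    by (subst (asm) nn_integral_0_iff_AE) auto
  moreover have "AE p in lborel \<Otimes>\<^sub>M lborel. snd p \<noteq> (m::real)"
  proof (rule lborel_pair.AE_pair_measure)
    show "{p \<in> space (lborel \<Otimes>\<^sub>M lborel). snd p \<noteq> m} \<in> sets (lborel \<Otimes>\<^sub>M lborel)" by measurable
    show "AE x in lborel. AE y in lborel. snd (x, y) \<noteq> m"
      using AE_lborel_singleton[of m] by simp
  qed
  ultimately have "AE p in lborel \<Otimes>\<^sub>M lborel. ennreal ((cmod (?S (fst p) (snd p)))\<^sup>2) = 0"
    by eventually_elim auto
  then have "(\<integral>\<^sup>+p. ennreal ((cmod (?S (fst p) (snd p)))\<^sup>2) \<partial>(lborel \<Otimes>\<^sub>M lborel)) = 0"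
    by (subst nn_integral_0_iff_AE) auto
  then show False
    using N nn_integral_eq_l2norm[OF sqint_windowed[OF fg]]
    unfolding nn_integral_stlct[OF b fg] by simp
qed

section \<open>The uncertainty inequality for the frequency spreads\<close>

theorem theorem2:
  fixes a1 b1 c1 d1 a2 b2 c2 d2 :: real and f g :: "real \<Rightarrow> complex"
  assumes "a1*d1 - b1*c1 = 1" and "a2*d2 - b2*c2 = 1" and "b1 \<noteq> 0" and "b2 \<noteq> 0"
    and "square_integrable f" and "square_integrable g"
    and "\<not> (AE x in lborel. f x = 0)" and "\<not> (AE x in lborel. g x = 0)"
    and "\<exists>F. is_lct (a1,b1,c1,d1) f F \<and> square_integrable (\<lambda>u. complex_of_real u * F u)"
    and "\<exists>F. is_lct (a2,b2,c2,d2) f F \<and> square_integrable (\<lambda>u. complex_of_real u * F u)"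
    and "\<exists>G. is_lct (a1,b1,c1,d1) g G \<and> square_integrable (\<lambda>u. complex_of_real u * G u)"
    and "\<exists>G. is_lct (a2,b2,c2,d2) g G \<and> square_integrable (\<lambda>u. complex_of_real u * G u)"
  shows "freq_spread (a1,b1,c1,d1) g f * freq_spread (a2,b2,c2,d2) g f
           \<ge> ennreal ((a1*b2 - a2*b1)\<^sup>2 / 4)"
proof -
  have fg: "sqint lborel f" "sqint lborel g"
    using assms(5,6) by (auto simp: square_integrable_def sqint_def)
  have [measurable]: "f \<in> borel_measurable borel" "g \<in> borel_measurable borel"
    using fg by (auto simp: sqint_def)
  define N where "N = l2norm lborel (windowed g f)"
  \<comment> \<open>The estimate below holds for arbitrary real centres, hence also if the integral
    in \<open>mean_freq\<close> takes its default value 0.\<close>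
  define m where "m = mean_freq (a1,b1,c1,d1) g f"
  define n where "n = mean_freq (a2,b2,c2,d2) g f"
  define X where "X = (\<integral>\<^sup>+p. ennreal ((snd p - m)\<^sup>2 *
      (cmod (stlct (a1,b1,c1,d1) g f (fst p) (snd p)))\<^sup>2) \<partial>(lborel \<Otimes>\<^sub>M lborel))"
  define Y where "Y = (\<integral>\<^sup>+p. ennreal ((snd p - n)\<^sup>2 *
      (cmod (stlct (a2,b2,c2,d2) g f (fst p) (snd p)))\<^sup>2) \<partial>(lborel \<Otimes>\<^sub>M lborel))"
  note H = sqint_windowed[OF fg]
  have norms: "stlct_norm2 (a1,b1,c1,d1) g f = N\<^sup>2" "stlct_norm2 (a2,b2,c2,d2) g f = N\<^sup>2"
    using assms(3,4) fg by (simp_all add: stlct_norm2_def nn_integral_stlct nn_integral_eq_l2norm[OF H] N_def)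
  \<comment> \<open>The squared norm of \<open>windowed g f\<close> is the product of those of
    \<open>f\<close> and \<open>g\<close>, so it is positive and division by it is genuine.\<close>
  have "(\<integral>\<^sup>+x. ennreal ((cmod (f x))\<^sup>2) \<partial>lborel) \<noteq> 0" "(\<integral>\<^sup>+x. ennreal ((cmod (g x))\<^sup>2) \<partial>lborel) \<noteq> 0"
    using assms(7,8) by (simp_all add: nn_integral_0_iff_AE)
  then have "ennreal (N\<^sup>2) \<noteq> 0"
    using nn_integral_windowed[of f g] by (simp add: N_def nn_integral_eq_l2norm[OF H, symmetric])
  then have N: "0 < N"
    using l2norm_nonneg[of lborel "windowed g f"] by (auto simp: N_def less_le)
  have spread: "freq_spread (a1,b1,c1,d1) g f * freq_spread (a2,b2,c2,d2) g f
      = ennreal (1 / N\<^sup>2) * X * (ennreal (1 / N\<^sup>2) * Y)"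
    unfolding freq_spread_def norms m_def[symmetric] n_def[symmetric] X_def Y_def ..
  have "X \<noteq> 0" "Y \<noteq> 0"
    unfolding X_def Y_def
    using stlct_second_moment_pos[OF assms(3) fg] stlct_second_moment_pos[OF assms(4) fg] N
    by (auto simp: N_def)
  show ?thesis
  \<comment> \<open>If one moment is infinite, positivity of the other makes the product infinite,
    as 0 times infinity would be 0 in \<open>ennreal\<close>.\<close>
  proof (cases "X = \<infinity> \<or> Y = \<infinity>")
    case True
    then have "ennreal (1 / N\<^sup>2) * X * (ennreal (1 / N\<^sup>2) * Y) = \<infinity>"
      using \<open>X \<noteq> 0\<close> \<open>Y \<noteq> 0\<close> N by (auto simp: ennreal_mult_eq_top_iff)
    then show ?thesis unfolding spread by simp
  next
    case False
    then obtain x y where xy: "X = ennreal x" "0 \<le> x" "Y = ennreal y" "0 \<le> y"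
      by (cases X; cases Y) auto
    \<comment> \<open>Taking square roots turns the extended mean-square estimate into the linear
      rate that \<open>Weyl_uncertainty\<close> expects.\<close>
    have bound: "l2norm lborel (\<lambda>p. displace a b k s (windowed g f) p - windowed g f p) \<le> \<bar>s\<bar> * sqrt z"
      if "(\<integral>\<^sup>+p. ennreal ((cmod (displace a b k s (windowed g f) p - windowed g f p))\<^sup>2) \<partial>lborel)
        \<le> ennreal (s\<^sup>2) * ennreal z" "0 \<le> z" for a b k s z
    proof -
      have "(l2norm lborel (\<lambda>p. displace a b k s (windowed g f) p - windowed g f p))\<^sup>2 \<le> s\<^sup>2 * z"
        using that nn_integral_eq_l2norm[OF sqint_diff[OF displace_sqint(1)[OF H] H], of a b k s]
        by (simp flip: ennreal_mult)
      then have "sqrt ((l2norm lborel (\<lambda>p. displace a b k s (windowed g f) p - windowed g f p))\<^sup>2) \<le> sqrt (s\<^sup>2 * z)"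
        by (rule real_sqrt_le_mono)
      then show ?thesis by (simp add: real_sqrt_mult l2norm_nonneg)
    qed
    have "\<bar>a1*b2 - a2*b1\<bar> * N\<^sup>2 \<le> 2 * sqrt x * sqrt y"
      unfolding N_def
      using displacement_bound_stlct[OF assms(3) fg, of a1 m _ c1 d1]
        displacement_bound_stlct[OF assms(4) fg, of a2 n _ c2 d2] xy
      by (intro Weyl_uncertainty[OF H, where m=m and n=n] bound) (auto simp: X_def Y_def)
    \<comment> \<open>Squaring and dividing by four times the fourth power of \<open>N\<close> gives
      the normalised spreads.\<close>
    then have "(\<bar>a1*b2 - a2*b1\<bar> * N\<^sup>2)\<^sup>2 \<le> (2 * sqrt x * sqrt y)\<^sup>2"
      by (intro power_mono) auto
    then have "(a1*b2 - a2*b1)\<^sup>2 * (N\<^sup>2)\<^sup>2 \<le> 4 * (x * y)"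
      using xy by (simp add: power_mult_distrib)
    then have "(a1*b2 - a2*b1)\<^sup>2 / 4 \<le> 1 / N\<^sup>2 * x * (1 / N\<^sup>2 * y)"
      using N by (simp add: field_simps power2_eq_square)
    then show ?thesis
      unfolding spread using xy by (simp add: ennreal_leI flip: ennreal_mult)
  qed
qed

end
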